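(* Let $\mathsf{C}$ be a strict braided monoidal category that admits split idempotents, and let $(H,m_{H},\Phi_{H})$ be a twisted post-Hopf algebra in $\mathsf{C}$ with $H$ cocommutative ($c_{H,H}\circ\delta_H=\delta_H$), such that $\tilde{\beta}_{H}:=(b_{H}(K)\otimes H)\circ(H\otimes\beta_{H})\colon H\otimes H\to H$ is a coalgebra morphism. Let $p_H\colon H\to I(\Phi_H)$, $i_H\colon I(\Phi_H)\to H$ be a splitting of the idempotent $\Phi_H$, i.e. $i_H\circ p_H=\Phi_H$ and $p_H\circ i_H=\mathrm{id}_{I(\Phi_H)}$. Then $I(\Phi_{H})$, with $$\mu_{I(\Phi_{H})}:= p_{H}\circ\overline{\mu}_{H}\circ(i_{H}\otimes i_{H}),\quad \eta_{I(\Phi_{H})}:= p_{H}\circ\eta_{H},\quad \delta_{I(\Phi_{H})}:=(p_{H}\otimes p_{H})\circ\delta_{H}\circ i_{H},\quad \varepsilon_{I(\Phi_{H})}:=\varepsilon_{H}\circ i_{H},$$ where $\overline{\mu}_{H}:=\mu_{H}\circ(\Phi_{H}\otimes m_{H})\circ(\delta_{H}\otimes H)$, is a cocommutative Hopf algebra in $\mathsf{C}$ with antipode $$\lambda_{I(\Phi_{H})}:= p_{H}\circ S_{H}\circ i_{H},\qquad S_{H}:=(b_{H}(K)\otimes H)\circ((\lambda_{H}\circ\Phi_{H})\otimes\beta_{H})\circ\delta_{H}.$$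
   Context: $\mathsf{C}=(\mathsf{C},\otimes,K,c)$ is a strict braided monoidal category with unit object $K$ and braiding $c_{M,N}\colon M\otimes N\to N\otimes M$. For an object $X$ and a morphism $f$, $X\otimes f$ and $f\otimes X$ denote $\mathrm{id}_X\otimes f$ and $f\otimes \mathrm{id}_X$. A Hopf algebra in $\mathsf{C}$ is $H=(H,\eta_H,\mu_H,\varepsilon_H,\delta_H,\lambda_H)$ (unit, product, counit, coproduct, antipode). The tensor product $D\otimes E$ of coalgebras has coproduct $(D\otimes c_{D,E}\otimes E)\circ(\delta_D\otimes\delta_E)$ and counit $\varepsilon_D\otimes\varepsilon_E$. $\mathsf{C}$ admits split idempotents if every idempotent $q\colon X\to X$ factors as $q=i\circ p$ with $p\colon X\to I(q)$, $i\colon I(q)\to X$ and $p\circ i=\mathrm{id}_{I(q)}$. An object $H$ is finite if there are an object $H^*$ and morphisms $a_H(K)\colon K\to H^*\otimes H$, $b_H(K)\colon H\otimes H^*\to K$ (unit and counit of the adjunction $H\otimes-\dashv H^*\otimes-$) with $(b_H(K)\otimes H)\circ(H\otimes a_H(K))=\mathrm{id}_H$ and $(H^*\otimes b_H(K))\circ(a_H(K)\otimes H^* )=\mathrm{id}_{H^*}$. Weak twisted post-Hopf algebra: a triple $(H,m_H,\Phi_H)$ with $H$ a Hopf algebra in $\mathsf{C}$ and morphisms $m_H\colon H\otimes H\to H$, $\Phi_H\colon H\to H$ such that: (i) $m_H$ is a coalgebra morphism; (ii) $\Phi_H$ is a coalgebra morphism; (iii) $\Phi_{H}\circ\mu_{H}\circ(\Phi_{H}\otimes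 m_{H})\circ(\delta_{H}\otimes H)=\mu_{H}\circ(\Phi_{H}\otimes m_{H})\circ(\delta_{H}\otimes \Phi_{H})$; (iv) $m_{H}\circ(H\otimes m_{H})=m_{H}\circ((\mu_{H}\circ(\Phi_{H}\otimes m_{H})\circ(\delta_{H}\otimes H))\otimes H)$; (v) $m_{H}\circ(H\otimes\mu_{H})=\mu_{H}\circ(m_{H}\otimes m_{H})\circ(H\otimes c_{H,H}\otimes H)\circ(\delta_{H}\otimes H\otimes H)$. Twisted post-Hopf algebra: a weak twisted post-Hopf algebra with $H$ finite such that (vi) $\Phi_H\circ\eta_H=\eta_H$; (vii) $\alpha_{H}:=(H^{*}\otimes m_{H})\circ(c_{H,H^{*}}\otimes H)\circ(H\otimes a_{H}(K))\colon H\to H^*\otimes H$ is convolution invertible, i.e. there is a (necessarily unique) $\beta_H\colon H\to H^*\otimes H$ with $(H^{*}\otimes b_{H}(K)\otimes H)\circ(\alpha_{H}\otimes\beta_{H})\circ\delta_{H}=\varepsilon_{H}\otimes a_{H}(K)=(H^{*}\otimes b_{H}(K)\otimes H)\circ(\beta_{H}\otimes\alpha_{H})\circ\delta_{H}$. For a twisted post-Hopf algebra the morphism $\Phi_H$ is idempotent. *)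

theory Defs
  imports Main
begin

section \<open>Strict braided monoidal categories\<close>

text \<open>
  Arrows determine their domain and codomain. The operations are total functions whose values
  are only constrained on objects and (composable) arrows. Composition is written in the usual
  order, \<open>g \<cdot> f\<close> being \<open>f\<close> followed by \<open>g\<close>; \<open>\<odot>\<close> is the tensor product of objects and \<open>\<otimes>\<close> that of
  arrows, and \<open>\<otimes>\<close> binds tighter than \<open>\<cdot>\<close>. \<open>\<K>\<close> is the unit object and \<open>\<one> X\<close> the identity of \<open>X\<close>.
\<close>

record ('o, 'm) category =
  Obj   :: "'o set"
  Arr   :: "'m set"
  Dom   :: "'m \<Rightarrow> 'o"
  Cod   :: "'m \<Rightarrow> 'o"
  Ident :: "'o \<Rightarrow> 'm"  ("\<one>\<index>")
  Cmp   :: "'m \<Rightarrow> 'm \<Rightarrow> 'm"  (infixr "\<cdot>\<index>" 70)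

record ('o, 'm) braided_category = "('o, 'm) category" +
  TenO  :: "'o \<Rightarrow> 'o \<Rightarrow> 'o"  (infixr "\<odot>\<index>" 75)
  TenM  :: "'m \<Rightarrow> 'm \<Rightarrow> 'm"  (infixr "\<otimes>\<index>" 75)
  UnitO :: 'o  ("\<K>\<index>")
  Braid :: "'o \<Rightarrow> 'o \<Rightarrow> 'm"  ("\<c>\<index>")

definition hom :: "('o, 'm, 'z) category_scheme \<Rightarrow> 'o \<Rightarrow> 'o \<Rightarrow> 'm set" where
  "hom C X Y = {f \<in> Arr C. Dom C f = X \<and> Cod C f = Y}"

locale category =
  fixes C :: "('o, 'm, 'z) category_scheme" (structure)
  assumes Dom_Obj: "f \<in> Arr C \<Longrightarrow> Dom C f \<in> Obj C"
    and Cod_Obj: "f \<in> Arr C \<Longrightarrow> Cod C f \<in> Obj C"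
    and Ident_hom: "X \<in> Obj C \<Longrightarrow> \<one> X \<in> hom C X X"
    and Cmp_hom: "\<lbrakk>f \<in> hom C X Y; g \<in> hom C Y Z\<rbrakk> \<Longrightarrow> g \<cdot> f \<in> hom C X Z"
    and Cmp_Ident_left: "f \<in> hom C X Y \<Longrightarrow> \<one> Y \<cdot> f = f"
    and Cmp_Ident_right: "f \<in> hom C X Y \<Longrightarrow> f \<cdot> \<one> X = f"
    and Cmp_assoc: "\<lbrakk>f \<in> hom C W X; g \<in> hom C X Y; h \<in> hom C Y Z\<rbrakk>
      \<Longrightarrow> (h \<cdot> g) \<cdot> f = h \<cdot> (g \<cdot> f)"

locale strict_monoidal_category = category C
  for C :: "('o, 'm, 'z) braided_category_scheme" (structure) +
  assumes UnitO_Obj: "\<K> \<in> Obj C"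
    and TenO_Obj: "\<lbrakk>X \<in> Obj C; Y \<in> Obj C\<rbrakk> \<Longrightarrow> X \<odot> Y \<in> Obj C"
    and TenM_hom: "\<lbrakk>f \<in> hom C X X'; g \<in> hom C Y Y'\<rbrakk> \<Longrightarrow> f \<otimes> g \<in> hom C (X \<odot> Y) (X' \<odot> Y')"
    and TenM_Ident: "\<lbrakk>X \<in> Obj C; Y \<in> Obj C\<rbrakk> \<Longrightarrow> \<one> X \<otimes> \<one> Y = \<one> (X \<odot> Y)"
    and TenM_Cmp: "\<lbrakk>f \<in> hom C X X'; f' \<in> hom C X' X''; g \<in> hom C Y Y'; g' \<in> hom C Y' Y''\<rbrakk>
      \<Longrightarrow> (f' \<cdot> f) \<otimes> (g' \<cdot> g) = (f' \<otimes> g') \<cdot> (f \<otimes> g)"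
    and TenO_assoc: "\<lbrakk>X \<in> Obj C; Y \<in> Obj C; Z \<in> Obj C\<rbrakk> \<Longrightarrow> (X \<odot> Y) \<odot> Z = X \<odot> (Y \<odot> Z)"
    and TenO_unit_left: "X \<in> Obj C \<Longrightarrow> \<K> \<odot> X = X"
    and TenO_unit_right: "X \<in> Obj C \<Longrightarrow> X \<odot> \<K> = X"
    and TenM_assoc: "\<lbrakk>f \<in> Arr C; g \<in> Arr C; h \<in> Arr C\<rbrakk> \<Longrightarrow> (f \<otimes> g) \<otimes> h = f \<otimes> (g \<otimes> h)"
    and TenM_unit_left: "f \<in> Arr C \<Longrightarrow> \<one> \<K> \<otimes> f = f"
    and TenM_unit_right: "f \<in> Arr C \<Longrightarrow> f \<otimes> \<one> \<K> = f"

locale strict_braided_monoidal_category = strict_monoidal_category C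
  for C :: "('o, 'm, 'z) braided_category_scheme" (structure) +
  assumes Braid_hom: "\<lbrakk>X \<in> Obj C; Y \<in> Obj C\<rbrakk> \<Longrightarrow> \<c> X Y \<in> hom C (X \<odot> Y) (Y \<odot> X)"
    and Braid_iso: "\<lbrakk>X \<in> Obj C; Y \<in> Obj C\<rbrakk> \<Longrightarrow>
      \<exists>d \<in> hom C (Y \<odot> X) (X \<odot> Y). d \<cdot> \<c> X Y = \<one> (X \<odot> Y) \<and> \<c> X Y \<cdot> d = \<one> (Y \<odot> X)"
    and Braid_natural: "\<lbrakk>f \<in> hom C X X'; g \<in> hom C Y Y'\<rbrakk>
      \<Longrightarrow> \<c> X' Y' \<cdot> (f \<otimes> g) = (g \<otimes> f) \<cdot> \<c> X Y"
    and Braid_TenO_right: "\<lbrakk>X \<in> Obj C; Y \<in> Obj C; Z \<in> Obj C\<rbrakk>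
      \<Longrightarrow> \<c> X (Y \<odot> Z) = (\<one> Y \<otimes> \<c> X Z) \<cdot> (\<c> X Y \<otimes> \<one> Z)"
    and Braid_TenO_left: "\<lbrakk>X \<in> Obj C; Y \<in> Obj C; Z \<in> Obj C\<rbrakk>
      \<Longrightarrow> \<c> (X \<odot> Y) Z = (\<c> X Z \<otimes> \<one> Y) \<cdot> (\<one> X \<otimes> \<c> Y Z)"

definition splitting ::
  "('o, 'm, 'z) category_scheme \<Rightarrow> 'o \<Rightarrow> 'm \<Rightarrow> 'o \<Rightarrow> 'm \<Rightarrow> 'm \<Rightarrow> bool" where
  "splitting C X q I p i \<longleftrightarrow> I \<in> Obj C \<and> p \<in> hom C X I \<and> i \<in> hom C I X \<and>
     Cmp C i p = q \<and> Cmp C p i = Ident C I"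

definition admits_split_idempotents :: "('o, 'm, 'z) category_scheme \<Rightarrow> bool" where
  "admits_split_idempotents C \<longleftrightarrow>
     (\<forall>X \<in> Obj C. \<forall>q \<in> hom C X X. Cmp C q q = q \<longrightarrow> (\<exists>I p i. splitting C X q I p i))"


section \<open>Hopf algebras in a braided category\<close>

record ('o, 'm) coalgebra =
  obj    :: 'o
  counit :: 'm  ("\<epsilon>\<index>")
  comult :: 'm  ("\<delta>\<index>")

record ('o, 'm) hopf = "('o, 'm) coalgebra" +
  unit     :: 'm  ("\<eta>\<index>")
  mult     :: 'm  ("\<mu>\<index>")
  antipode :: 'm

context
  fixes C :: "('o, 'm, 'z) braided_category_scheme" (structure)
begin

definition coalgebra :: "('o, 'm, 'y) coalgebra_scheme \<Rightarrow> bool" where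
  "coalgebra D \<longleftrightarrow> obj D \<in> Obj C \<and>
     \<epsilon>\<^bsub>D\<^esub> \<in> hom C (obj D) \<K> \<and> \<delta>\<^bsub>D\<^esub> \<in> hom C (obj D) (obj D \<odot> obj D) \<and>
     (\<epsilon>\<^bsub>D\<^esub> \<otimes> \<one> (obj D)) \<cdot> \<delta>\<^bsub>D\<^esub> = \<one> (obj D) \<and>
     (\<one> (obj D) \<otimes> \<epsilon>\<^bsub>D\<^esub>) \<cdot> \<delta>\<^bsub>D\<^esub> = \<one> (obj D) \<and>
     (\<delta>\<^bsub>D\<^esub> \<otimes> \<one> (obj D)) \<cdot> \<delta>\<^bsub>D\<^esub> = (\<one> (obj D) \<otimes> \<delta>\<^bsub>D\<^esub>) \<cdot> \<delta>\<^bsub>D\<^esub>"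

definition coalgebra_morphism ::
  "('o, 'm, 'x) coalgebra_scheme \<Rightarrow> ('o, 'm, 'y) coalgebra_scheme \<Rightarrow> 'm \<Rightarrow> bool" where
  "coalgebra_morphism D E f \<longleftrightarrow> f \<in> hom C (obj D) (obj E) \<and>
     \<epsilon>\<^bsub>E\<^esub> \<cdot> f = \<epsilon>\<^bsub>D\<^esub> \<and> \<delta>\<^bsub>E\<^esub> \<cdot> f = (f \<otimes> f) \<cdot> \<delta>\<^bsub>D\<^esub>"

definition unit_coalgebra :: "('o, 'm) coalgebra" where
  "unit_coalgebra = \<lparr>obj = \<K>, counit = \<one> \<K>, comult = \<one> \<K>\<rparr>"

definition tensor_coalgebra ::
  "('o, 'm, 'x) coalgebra_scheme \<Rightarrow> ('o, 'm, 'y) coalgebra_scheme \<Rightarrow> ('o, 'm) coalgebra" where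
  "tensor_coalgebra D E =
     \<lparr>obj = obj D \<odot> obj E, counit = \<epsilon>\<^bsub>D\<^esub> \<otimes> \<epsilon>\<^bsub>E\<^esub>,
      comult = (\<one> (obj D) \<otimes> \<c> (obj D) (obj E) \<otimes> \<one> (obj E)) \<cdot> (\<delta>\<^bsub>D\<^esub> \<otimes> \<delta>\<^bsub>E\<^esub>)\<rparr>"

definition cocommutative :: "('o, 'm, 'y) coalgebra_scheme \<Rightarrow> bool" where
  "cocommutative D \<longleftrightarrow> \<c> (obj D) (obj D) \<cdot> \<delta>\<^bsub>D\<^esub> = \<delta>\<^bsub>D\<^esub>"

definition algebra :: "('o, 'm, 'y) hopf_scheme \<Rightarrow> bool" where
  "algebra A \<longleftrightarrow> obj A \<in> Obj C \<and>
     \<eta>\<^bsub>A\<^esub> \<in> hom C \<K> (obj A) \<and> \<mu>\<^bsub>A\<^esub> \<in> hom C (obj A \<odot> obj A) (obj A) \<and>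
     \<mu>\<^bsub>A\<^esub> \<cdot> (\<eta>\<^bsub>A\<^esub> \<otimes> \<one> (obj A)) = \<one> (obj A) \<and>
     \<mu>\<^bsub>A\<^esub> \<cdot> (\<one> (obj A) \<otimes> \<eta>\<^bsub>A\<^esub>) = \<one> (obj A) \<and>
     \<mu>\<^bsub>A\<^esub> \<cdot> (\<mu>\<^bsub>A\<^esub> \<otimes> \<one> (obj A)) = \<mu>\<^bsub>A\<^esub> \<cdot> (\<one> (obj A) \<otimes> \<mu>\<^bsub>A\<^esub>)"

definition bialgebra :: "('o, 'm, 'y) hopf_scheme \<Rightarrow> bool" where
  "bialgebra H \<longleftrightarrow> algebra H \<and> coalgebra H \<and>
     coalgebra_morphism unit_coalgebra H \<eta>\<^bsub>H\<^esub> \<and>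
     coalgebra_morphism (tensor_coalgebra H H) H \<mu>\<^bsub>H\<^esub>"

definition hopf_algebra :: "('o, 'm, 'y) hopf_scheme \<Rightarrow> bool" where
  "hopf_algebra H \<longleftrightarrow> bialgebra H \<and>
     antipode H \<in> hom C (obj H) (obj H) \<and>
     \<mu>\<^bsub>H\<^esub> \<cdot> (\<one> (obj H) \<otimes> antipode H) \<cdot> \<delta>\<^bsub>H\<^esub> = \<eta>\<^bsub>H\<^esub> \<cdot> \<epsilon>\<^bsub>H\<^esub> \<and>
     \<mu>\<^bsub>H\<^esub> \<cdot> (antipode H \<otimes> \<one> (obj H)) \<cdot> \<delta>\<^bsub>H\<^esub> = \<eta>\<^bsub>H\<^esub> \<cdot> \<epsilon>\<^bsub>H\<^esub>"


section \<open>Twisted post-Hopf algebras\<close>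

text \<open>
  \<open>finite_via X Xs a b\<close>: the object \<open>X\<close> is finite, as witnessed by the dual object \<open>Xs\<close> and the
  components at \<open>\<K>\<close> of the unit (\<open>a\<close>) and counit (\<open>b\<close>) of the adjunction \<open>X \<otimes> - \<stileturn> Xs \<otimes> -\<close>.
\<close>

definition finite_via :: "'o \<Rightarrow> 'o \<Rightarrow> 'm \<Rightarrow> 'm \<Rightarrow> bool" where
  "finite_via X Xs a b \<longleftrightarrow> X \<in> Obj C \<and> Xs \<in> Obj C \<and>
     a \<in> hom C \<K> (Xs \<odot> X) \<and> b \<in> hom C (X \<odot> Xs) \<K> \<and>
     (b \<otimes> \<one> X) \<cdot> (\<one> X \<otimes> a) = \<one> X \<and>
     (\<one> Xs \<otimes> b) \<cdot> (a \<otimes> \<one> Xs) = \<one> Xs"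

definition mu_bar :: "('o, 'm, 'y) hopf_scheme \<Rightarrow> 'm \<Rightarrow> 'm \<Rightarrow> 'm" where
  "mu_bar H m \<Phi> = \<mu>\<^bsub>H\<^esub> \<cdot> (\<Phi> \<otimes> m) \<cdot> (\<delta>\<^bsub>H\<^esub> \<otimes> \<one> (obj H))"

definition weak_twisted_post_hopf_algebra :: "('o, 'm, 'y) hopf_scheme \<Rightarrow> 'm \<Rightarrow> 'm \<Rightarrow> bool" where
  "weak_twisted_post_hopf_algebra H m \<Phi> \<longleftrightarrow> hopf_algebra H \<and>
     coalgebra_morphism (tensor_coalgebra H H) H m \<and>
     coalgebra_morphism H H \<Phi> \<and>
     \<Phi> \<cdot> \<mu>\<^bsub>H\<^esub> \<cdot> (\<Phi> \<otimes> m) \<cdot> (\<delta>\<^bsub>H\<^esub> \<otimes> \<one> (obj H)) = \<mu>\<^bsub>H\<^esub> \<cdot> (\<Phi> \<otimes> m) \<cdot> (\<delta>\<^bsub>H\<^esub> \<otimes> \<Phi>) \<and>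
     m \<cdot> (\<one> (obj H) \<otimes> m) =
       m \<cdot> ((\<mu>\<^bsub>H\<^esub> \<cdot> (\<Phi> \<otimes> m) \<cdot> (\<delta>\<^bsub>H\<^esub> \<otimes> \<one> (obj H))) \<otimes> \<one> (obj H)) \<and>
     m \<cdot> (\<one> (obj H) \<otimes> \<mu>\<^bsub>H\<^esub>) =
       \<mu>\<^bsub>H\<^esub> \<cdot> (m \<otimes> m) \<cdot> (\<one> (obj H) \<otimes> \<c> (obj H) (obj H) \<otimes> \<one> (obj H))
         \<cdot> (\<delta>\<^bsub>H\<^esub> \<otimes> \<one> (obj H) \<otimes> \<one> (obj H))"

definition alpha :: "('o, 'm, 'y) hopf_scheme \<Rightarrow> 'm \<Rightarrow> 'o \<Rightarrow> 'm \<Rightarrow> 'm" where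
  "alpha H m Hs a =
     (\<one> Hs \<otimes> m) \<cdot> (\<c> (obj H) Hs \<otimes> \<one> (obj H)) \<cdot> (\<one> (obj H) \<otimes> a)"

text \<open>
  \<open>Hs \<odot> obj H\<close> is an algebra with unit \<open>a\<close> and product \<open>\<one> Hs \<otimes> b \<otimes> \<one> (obj H)\<close>; the convolution
  below is taken with respect to it. In \<open>\<epsilon> \<otimes> a\<close> the identities \<open>obj H \<odot> \<K> = obj H\<close> and
  \<open>\<K> \<odot> Hs \<odot> obj H = Hs \<odot> obj H\<close> are used.
\<close>

definition convolution_inverse ::
  "('o, 'm, 'y) hopf_scheme \<Rightarrow> 'o \<Rightarrow> 'm \<Rightarrow> 'm \<Rightarrow> 'm \<Rightarrow> 'm \<Rightarrow> bool" where
  "convolution_inverse H Hs a b f g \<longleftrightarrow> g \<in> hom C (obj H) (Hs \<odot> obj H) \<and>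
     (\<one> Hs \<otimes> b \<otimes> \<one> (obj H)) \<cdot> (f \<otimes> g) \<cdot> \<delta>\<^bsub>H\<^esub> = \<epsilon>\<^bsub>H\<^esub> \<otimes> a \<and>
     (\<one> Hs \<otimes> b \<otimes> \<one> (obj H)) \<cdot> (g \<otimes> f) \<cdot> \<delta>\<^bsub>H\<^esub> = \<epsilon>\<^bsub>H\<^esub> \<otimes> a"

definition twisted_post_hopf_algebra ::
  "('o, 'm, 'y) hopf_scheme \<Rightarrow> 'm \<Rightarrow> 'm \<Rightarrow> 'o \<Rightarrow> 'm \<Rightarrow> 'm \<Rightarrow> bool" where
  "twisted_post_hopf_algebra H m \<Phi> Hs a b \<longleftrightarrow> weak_twisted_post_hopf_algebra H m \<Phi> \<and>
     finite_via (obj H) Hs a b \<and>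
     \<Phi> \<cdot> \<eta>\<^bsub>H\<^esub> = \<eta>\<^bsub>H\<^esub> \<and>
     (\<exists>\<beta>. convolution_inverse H Hs a b (alpha H m Hs a) \<beta>)"

definition beta_tilde :: "('o, 'm, 'y) hopf_scheme \<Rightarrow> 'm \<Rightarrow> 'm \<Rightarrow> 'm" where
  "beta_tilde H b \<beta> = (b \<otimes> \<one> (obj H)) \<cdot> (\<one> (obj H) \<otimes> \<beta>)"

definition S_mor :: "('o, 'm, 'y) hopf_scheme \<Rightarrow> 'm \<Rightarrow> 'm \<Rightarrow> 'm \<Rightarrow> 'm" where
  "S_mor H \<Phi> b \<beta> = (b \<otimes> \<one> (obj H)) \<cdot> ((antipode H \<cdot> \<Phi>) \<otimes> \<beta>) \<cdot> \<delta>\<^bsub>H\<^esub>"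

definition image_hopf ::
  "('o, 'm, 'y) hopf_scheme \<Rightarrow> 'm \<Rightarrow> 'm \<Rightarrow> 'm \<Rightarrow> 'm \<Rightarrow> 'o \<Rightarrow> 'm \<Rightarrow> 'm \<Rightarrow> ('o, 'm) hopf" where
  "image_hopf H m \<Phi> b \<beta> I p i =
     \<lparr>obj = I,
      counit = \<epsilon>\<^bsub>H\<^esub> \<cdot> i,
      comult = (p \<otimes> p) \<cdot> \<delta>\<^bsub>H\<^esub> \<cdot> i,
      unit = p \<cdot> \<eta>\<^bsub>H\<^esub>,
      mult = p \<cdot> mu_bar H m \<Phi> \<cdot> (i \<otimes> i),
      antipode = p \<cdot> S_mor H \<Phi> b \<beta> \<cdot> i\<rparr>"

end

end

theory Submission
  imports Defs
begin

text \<open>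
  Write \<open>x * y = \<Phi> x\<^sub>1 (x\<^sub>2 \<rhd> y)\<close> for the product \<open>mu_bar\<close>, where \<open>x \<rhd> y\<close> stands for the morphism
  \<open>m\<close>, and \<open>\<eta>\<close> for the unit of \<open>H\<close>. On \<open>H\<close> itself, \<open>*\<close> is associative with left unit \<open>\<eta>\<close>, while
  \<open>x * \<eta> = \<Phi> x\<close>, and \<open>\<Phi> (x * y) = x * \<Phi> y\<close>. The last identity says that \<open>*\<close> maps the image of
  \<open>\<Phi>\<close> into itself, and on that image \<open>\<eta>\<close> is also a right unit; so the image is an algebra. It is a
  cocommutative coalgebra because \<open>\<Phi>\<close> is a coalgebra morphism, and \<open>*\<close> is a coalgebra morphism
  because, \<open>H\<close> being cocommutative, its coproduct is one.

  The unit laws come from two uniqueness arguments. The morphism \<open>x \<mapsto> x \<rhd> \<eta>\<close> is a coalgebra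
  morphism that is idempotent for convolution, hence equals \<open>\<eta> \<cdot> \<epsilon>\<close> (\<open>act_unit\<close>). The morphism
  \<open>y \<mapsto> \<eta> \<rhd> y\<close> is idempotent for composition and, the action being convolution invertible, split
  mono, hence is the identity (\<open>act_one\<close>).

  For the antipode, the dual object is eliminated first: a morphism \<open>f\<close> from \<open>H\<close> to \<open>Hs \<odot> H\<close>
  amounts to a morphism \<open>beta_tilde f\<close> from \<open>H \<odot> H\<close> to \<open>H\<close>, and convolution becomes an action-like
  composition (\<open>beta_tilde_conv\<close>). The one that belongs to \<open>alpha\<close> becomes \<open>m\<close> after precomposition
  with the braiding (\<open>act_op_Braid\<close>). With cocommutativity this gives \<open>x\<^sub>1 \<rhd> S x\<^sub>2 = \<lambda> (\<Phi> x)\<close>,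
  where \<open>\<lambda>\<close> is the antipode of \<open>H\<close>, whence \<open>x\<^sub>1 * S x\<^sub>2 = \<epsilon> x \<eta>\<close> (\<open>mu_bar_S\<close>). So \<open>S\<close> induces a
  right convolution inverse \<open>s\<close> of the identity on the image. Moreover \<open>S\<close> is a coalgebra morphism, being
  built from \<open>beta_tilde \<beta>\<close> and the antipode of \<open>H\<close>, which is a coalgebra morphism by
  cocommutativity. Then \<open>s \<cdot> s\<close> is a right convolution inverse of \<open>s\<close>, so \<open>s \<cdot> s\<close> is the identity and
  \<open>s\<close> is a left inverse as well (\<open>right_antipode_imp_left_antipode\<close>).
\<close>

section \<open>Diagrams in strict monoidal categories\<close>

text \<open>
  The axioms are restated in terms of \<open>Arr\<close>, \<open>Dom\<close> and \<open>Cod\<close>, so that the simplifier can infer the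
  types of composite arrows.
\<close>

context category
begin

lemma in_homI: "\<lbrakk>f \<in> Arr C; Dom C f = X; Cod C f = Y\<rbrakk> \<Longrightarrow> f \<in> hom C X Y"
  by (simp add: hom_def)

lemma in_homD:
  assumes "f \<in> hom C X Y"
  shows "f \<in> Arr C" "Dom C f = X" "Cod C f = Y" "X \<in> Obj C" "Y \<in> Obj C"
  using assms Dom_Obj Cod_Obj by (auto simp: hom_def)

lemma arr_hom: "f \<in> Arr C \<Longrightarrow> f \<in> hom C (Dom C f) (Cod C f)"
  by (simp add: hom_def)

lemma Ident_arr [simp]:
  assumes "X \<in> Obj C"
  shows "\<one> X \<in> Arr C" "Dom C (\<one> X) = X" "Cod C (\<one> X) = X"
  using in_homD[OF Ident_hom[OF assms]] by auto

lemma Cmp_arr [simp]: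
  assumes "f \<in> Arr C" "g \<in> Arr C" "Dom C g = Cod C f"
  shows "g \<cdot> f \<in> Arr C" "Dom C (g \<cdot> f) = Dom C f" "Cod C (g \<cdot> f) = Cod C g"
  using in_homD[OF Cmp_hom[OF arr_hom arr_hom[of g, unfolded assms(3)]]] assms by auto

lemma arr_Obj [simp]:
  assumes "f \<in> Arr C" shows "Dom C f \<in> Obj C" "Cod C f \<in> Obj C"
  using assms Dom_Obj Cod_Obj by auto

lemma Cmp_one_left: "\<lbrakk>f \<in> Arr C; Cod C f = X\<rbrakk> \<Longrightarrow> \<one> X \<cdot> f = f"
  using Cmp_Ident_left[OF arr_hom] by blast

lemma Cmp_one_right: "\<lbrakk>f \<in> Arr C; Dom C f = X\<rbrakk> \<Longrightarrow> f \<cdot> \<one> X = f"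
  using Cmp_Ident_right[OF arr_hom] by blast

lemma Cmp_assoc_arr:
  assumes "f \<in> Arr C" "g \<in> Arr C" "h \<in> Arr C" "Dom C g = Cod C f" "Dom C h = Cod C g"
  shows "(h \<cdot> g) \<cdot> f = h \<cdot> (g \<cdot> f)"
  by (rule Cmp_assoc[of f "Dom C f" "Cod C f" g "Cod C g" h "Cod C h"])
     (use assms in \<open>auto simp: hom_def\<close>)

lemma Cmp_chain:
  assumes "g \<cdot> f = k" "f \<in> Arr C" "g \<in> Arr C" "h \<in> Arr C" "Dom C g = Cod C f" "Dom C f = Cod C h"
  shows "g \<cdot> f \<cdot> h = k \<cdot> h"
  using assms by (simp add: Cmp_assoc_arr[symmetric])

end

context strict_monoidal_category
begin

declare UnitO_Obj [simp] TenO_Obj [simp] TenO_assoc [simp] TenO_unit_left [simp] TenO_unit_right [simp]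

lemma TenM_arr [simp]:
  assumes "f \<in> Arr C" "g \<in> Arr C"
  shows "f \<otimes> g \<in> Arr C" "Dom C (f \<otimes> g) = Dom C f \<odot> Dom C g" "Cod C (f \<otimes> g) = Cod C f \<odot> Cod C g"
  using in_homD[OF TenM_hom[OF arr_hom[OF assms(1)] arr_hom[OF assms(2)]]] by auto

lemma interchange:
  assumes "f \<in> Arr C" "g \<in> Arr C" "f' \<in> Arr C" "g' \<in> Arr C" "Dom C f' = Cod C f" "Dom C g' = Cod C g"
  shows "(f' \<otimes> g') \<cdot> (f \<otimes> g) = (f' \<cdot> f) \<otimes> (g' \<cdot> g)"
  by (rule TenM_Cmp[symmetric, of f "Dom C f" "Cod C f" f' "Cod C f'" g "Dom C g" "Cod C g" g' "Cod C g'"])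
     (use assms in \<open>auto simp: hom_def\<close>)

lemma interchange_chain:
  assumes "f \<in> Arr C" "g \<in> Arr C" "f' \<in> Arr C" "g' \<in> Arr C" "Dom C f' = Cod C f" "Dom C g' = Cod C g"
    "h \<in> Arr C" "Cod C h = Dom C f \<odot> Dom C g"
  shows "(f' \<otimes> g') \<cdot> (f \<otimes> g) \<cdot> h = ((f' \<cdot> f) \<otimes> (g' \<cdot> g)) \<cdot> h"
  using assms by (simp add: interchange Cmp_assoc_arr[symmetric])

text \<open>
  Tensor products are normalised by nesting them to the right, which hides some redexes of the
  interchange law, and so does composition. These are variants of the law for tensor factors that
  are grouped differently, and for arrows at the head of a longer composite.
\<close>

lemma interchange_split:
  assumes "f \<in> Arr C" "g \<in> Arr C" "f1 \<in> Arr C" "f2 \<in> Arr C" "g' \<in> Arr C"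
    "Cod C f = Dom C f1 \<odot> Dom C f2" "Dom C g' = Cod C g"
  shows "(f1 \<otimes> f2 \<otimes> g') \<cdot> (f \<otimes> g) = ((f1 \<otimes> f2) \<cdot> f) \<otimes> (g' \<cdot> g)"
  using interchange[of f g "f1 \<otimes> f2" g'] assms by (simp add: TenM_assoc)

lemma interchange_split_chain:
  assumes "f \<in> Arr C" "g \<in> Arr C" "f1 \<in> Arr C" "f2 \<in> Arr C" "g' \<in> Arr C"
    "Cod C f = Dom C f1 \<odot> Dom C f2" "Dom C g' = Cod C g"
    "h \<in> Arr C" "Cod C h = Dom C f \<odot> Dom C g"
  shows "(f1 \<otimes> f2 \<otimes> g') \<cdot> (f \<otimes> g) \<cdot> h = (((f1 \<otimes> f2) \<cdot> f) \<otimes> (g' \<cdot> g)) \<cdot> h"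
  using interchange_chain[of f g "f1 \<otimes> f2" g'] assms by (simp add: TenM_assoc)

lemma interchange_split3:
  assumes "f \<in> Arr C" "g \<in> Arr C" "f1 \<in> Arr C" "f2 \<in> Arr C" "f3 \<in> Arr C" "g' \<in> Arr C"
    "Cod C f = Dom C f1 \<odot> Dom C f2 \<odot> Dom C f3" "Dom C g' = Cod C g"
  shows "(f1 \<otimes> f2 \<otimes> f3 \<otimes> g') \<cdot> (f \<otimes> g) = ((f1 \<otimes> f2 \<otimes> f3) \<cdot> f) \<otimes> (g' \<cdot> g)"
  using interchange[of f g "f1 \<otimes> f2 \<otimes> f3" g'] assms by (simp add: TenM_assoc)

lemma interchange_join:
  assumes "f \<in> Arr C" "g \<in> Arr C" "f1 \<in> Arr C" "f2 \<in> Arr C" "g' \<in> Arr C"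
    "Dom C f = Cod C f1 \<odot> Cod C f2" "Dom C g = Cod C g'"
  shows "(f \<otimes> g) \<cdot> (f1 \<otimes> f2 \<otimes> g') = (f \<cdot> (f1 \<otimes> f2)) \<otimes> (g \<cdot> g')"
  using interchange[of "f1 \<otimes> f2" g' f g] assms by (simp add: TenM_assoc)

lemma interchange_join_chain:
  assumes "f \<in> Arr C" "g \<in> Arr C" "f1 \<in> Arr C" "f2 \<in> Arr C" "g' \<in> Arr C"
    "Dom C f = Cod C f1 \<odot> Cod C f2" "Dom C g = Cod C g'"
    "h \<in> Arr C" "Cod C h = Dom C f1 \<odot> Dom C f2 \<odot> Dom C g'"
  shows "(f \<otimes> g) \<cdot> (f1 \<otimes> f2 \<otimes> g') \<cdot> h = ((f \<cdot> (f1 \<otimes> f2)) \<otimes> (g \<cdot> g')) \<cdot> h"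
  using interchange_chain[of "f1 \<otimes> f2" g' f g] assms by (simp add: TenM_assoc)

lemma Ident_TenO: "\<lbrakk>X \<in> Obj C; Y \<in> Obj C\<rbrakk> \<Longrightarrow> \<one> (X \<odot> Y) = \<one> X \<otimes> \<one> Y"
  by (simp add: TenM_Ident)

lemma Ident_TenM_left:
  assumes "f \<in> Arr C" "X \<in> Obj C" "Y \<in> Obj C"
  shows "Cod C f = X \<odot> Y \<Longrightarrow> (\<one> X \<otimes> \<one> Y) \<cdot> f = f"
    "Z \<in> Obj C \<Longrightarrow> Cod C f = X \<odot> Y \<odot> Z \<Longrightarrow> (\<one> X \<otimes> \<one> Y \<otimes> \<one> Z) \<cdot> f = f"
  using assms by (simp_all add: TenM_Ident Cmp_one_left)

lemma Ident_TenM_right: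
  assumes "f \<in> Arr C" "X \<in> Obj C" "Y \<in> Obj C"
  shows "Dom C f = X \<odot> Y \<Longrightarrow> f \<cdot> (\<one> X \<otimes> \<one> Y) = f"
    "Z \<in> Obj C \<Longrightarrow> Dom C f = X \<odot> Y \<odot> Z \<Longrightarrow> f \<cdot> (\<one> X \<otimes> \<one> Y \<otimes> \<one> Z) = f"
  using assms by (simp_all add: TenM_Ident Cmp_one_right)

lemma TenM_Cmp_left:
  assumes "f \<in> Arr C" "g \<in> Arr C" "h \<in> Arr C" "Dom C g = Cod C f"
  shows "(g \<cdot> f) \<otimes> h = (g \<otimes> \<one> (Cod C h)) \<cdot> (f \<otimes> h)"
  using assms by (simp add: interchange Cmp_one_left)

lemma TenM_Cmp_right:
  assumes "f \<in> Arr C" "g \<in> Arr C" "h \<in> Arr C" "Dom C g = Cod C f"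
  shows "h \<otimes> (g \<cdot> f) = (\<one> (Cod C h) \<otimes> g) \<cdot> (h \<otimes> f)"
  using assms by (simp add: interchange Cmp_one_left)

text \<open>
  Two ways to rearrange diagrams. The rules \<open>layers\<close> pull compositions out of tensor products: a diagram
  becomes a composite of tensor products of basic arrows. The rules \<open>diag\<close> go the other way and push
  compositions into tensor products where the factors match. Used together they do not terminate.
\<close>

lemmas layers = Cmp_one_left Cmp_one_right Cmp_assoc_arr TenM_assoc Ident_TenO
  TenM_unit_left TenM_unit_right Ident_TenM_left Ident_TenM_right TenM_Cmp_left TenM_Cmp_right

lemmas diag = Ident_TenM_left Ident_TenM_right Cmp_one_left Cmp_one_right Cmp_assoc_arr TenM_assoc Ident_TenO
  TenM_unit_left TenM_unit_right
  interchange interchange_chain interchange_split interchange_split_chain interchange_split3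
  interchange_join interchange_join_chain

text \<open>A tensor factor that ends in the unit object slides past a composition.\<close>

lemma slide_left:
  assumes "f \<in> Arr C" "g \<in> Arr C" "h \<in> Arr C" "Cod C f = \<K>" "Dom C h = Cod C g"
  shows "h \<cdot> (f \<otimes> g) = f \<otimes> (h \<cdot> g)"
  using interchange[of f g "\<one> \<K>" h] assms by (simp add: TenM_unit_left Cmp_one_left)

lemma slide_right:
  assumes "f \<in> Arr C" "g \<in> Arr C" "h \<in> Arr C" "Cod C f = \<K>" "Dom C h = Cod C g"
  shows "h \<cdot> (g \<otimes> f) = (h \<cdot> g) \<otimes> f"
  using interchange[of g f h "\<one> \<K>"] assms by (simp add: TenM_unit_right Cmp_one_left)

lemma slide_left_chain:
  assumes "f \<in> Arr C" "g \<in> Arr C" "h \<in> Arr C" "k \<in> Arr C" "Cod C f = \<K>" "Dom C h = Cod C g"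
    "Cod C k = Dom C f \<odot> Dom C g"
  shows "h \<cdot> (f \<otimes> g) \<cdot> k = (f \<otimes> (h \<cdot> g)) \<cdot> k"
  using slide_left[of f g h] assms by (simp add: Cmp_assoc_arr[symmetric])

lemma slide_right_chain:
  assumes "f \<in> Arr C" "g \<in> Arr C" "h \<in> Arr C" "k \<in> Arr C" "Cod C f = \<K>" "Dom C h = Cod C g"
    "Cod C k = Dom C g \<odot> Dom C f"
  shows "h \<cdot> (g \<otimes> f) \<cdot> k = ((h \<cdot> g) \<otimes> f) \<cdot> k"
  using slide_right[of f g h] assms by (simp add: Cmp_assoc_arr[symmetric])

lemmas slide = slide_left slide_right slide_left_chain slide_right_chain

text \<open>Dually, a tensor factor that starts in the unit object can be applied last.\<close>

lemma TenM_unit_dom: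
  assumes "f \<in> Arr C" "h \<in> Arr C" "Dom C f = \<K>"
  shows "h \<otimes> f = (\<one> (Cod C h) \<otimes> f) \<cdot> h"
  using interchange[of h "\<one> \<K>" "\<one> (Cod C h)" f] assms
  by (simp add: TenM_unit_right Cmp_one_left Cmp_one_right)

end

context strict_braided_monoidal_category
begin

section \<open>Braidings with the unit object\<close>

lemma Braid_arr [simp]:
  assumes "X \<in> Obj C" "Y \<in> Obj C"
  shows "\<c> X Y \<in> Arr C" "Dom C (\<c> X Y) = X \<odot> Y" "Cod C (\<c> X Y) = Y \<odot> X"
  using in_homD[OF Braid_hom[OF assms]] by auto

lemma Braid_nat:
  assumes "f \<in> Arr C" "g \<in> Arr C" "Cod C f = X" "Cod C g = Y"
  shows "\<c> X Y \<cdot> (f \<otimes> g) = (g \<otimes> f) \<cdot> \<c> (Dom C f) (Dom C g)"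
  using Braid_natural[OF arr_hom arr_hom] assms by blast

lemma idempotent_iso_Ident:
  assumes "f \<in> hom C X X" "d \<in> hom C X X" "d \<cdot> f = \<one> X" "f \<cdot> f = f"
  shows "f = \<one> X"
proof -
  have "f = (d \<cdot> f) \<cdot> f" using assms(3) Cmp_Ident_left[OF assms(1)] by simp
  also have "\<dots> = d \<cdot> (f \<cdot> f)" by (rule Cmp_assoc[OF assms(1,1,2)])
  also have "\<dots> = \<one> X" using assms(3,4) by simp
  finally show ?thesis .
qed

lemma Braid_unit_right:
  assumes X: "X \<in> Obj C" shows "\<c> X \<K> = \<one> X"
proof -
  obtain d where d: "d \<in> hom C (\<K> \<odot> X) (X \<odot> \<K>)" "d \<cdot> \<c> X \<K> = \<one> (X \<odot> \<K>)"
    using Braid_iso[OF X UnitO_Obj] by blast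
  have "\<c> X \<K> \<cdot> \<c> X \<K> = \<c> X \<K>"
    using Braid_TenO_right[OF X UnitO_Obj UnitO_Obj] X by (simp add: TenM_unit_left TenM_unit_right)
  then show ?thesis
    using idempotent_iso_Ident[of "\<c> X \<K>" X d] d X by (simp add: in_homI)
qed

lemma Braid_unit_left:
  assumes X: "X \<in> Obj C" shows "\<c> \<K> X = \<one> X"
proof -
  obtain d where d: "d \<in> hom C (X \<odot> \<K>) (\<K> \<odot> X)" "d \<cdot> \<c> \<K> X = \<one> (\<K> \<odot> X)"
    using Braid_iso[OF UnitO_Obj X] by blast
  have "\<c> \<K> X \<cdot> \<c> \<K> X = \<c> \<K> X"
    using Braid_TenO_left[OF UnitO_Obj UnitO_Obj X] X by (simp add: TenM_unit_left TenM_unit_right)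
  then show ?thesis
    using idempotent_iso_Ident[of "\<c> \<K> X" X d] d X by (simp add: in_homI)
qed

section \<open>Convolution\<close>

lemma coalgebraD:
  assumes "coalgebra C D"
  shows "obj D \<in> Obj C" "\<epsilon>\<^bsub>D\<^esub> \<in> Arr C" "Dom C \<epsilon>\<^bsub>D\<^esub> = obj D" "Cod C \<epsilon>\<^bsub>D\<^esub> = \<K>"
    "\<delta>\<^bsub>D\<^esub> \<in> Arr C" "Dom C \<delta>\<^bsub>D\<^esub> = obj D" "Cod C \<delta>\<^bsub>D\<^esub> = obj D \<odot> obj D"
  using assms unfolding coalgebra_def by (auto simp: in_homD)

lemma coalgebra_laws:
  assumes "coalgebra C D"
  shows "(\<epsilon>\<^bsub>D\<^esub> \<otimes> \<one> (obj D)) \<cdot> \<delta>\<^bsub>D\<^esub> = \<one> (obj D)" "(\<one> (obj D) \<otimes> \<epsilon>\<^bsub>D\<^esub>) \<cdot> \<delta>\<^bsub>D\<^esub> = \<one> (obj D)"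
    "(\<delta>\<^bsub>D\<^esub> \<otimes> \<one> (obj D)) \<cdot> \<delta>\<^bsub>D\<^esub> = (\<one> (obj D) \<otimes> \<delta>\<^bsub>D\<^esub>) \<cdot> \<delta>\<^bsub>D\<^esub>"
  using assms unfolding coalgebra_def by blast+

lemma algebraD:
  assumes "algebra C A"
  shows "obj A \<in> Obj C" "\<eta>\<^bsub>A\<^esub> \<in> Arr C" "Dom C \<eta>\<^bsub>A\<^esub> = \<K>" "Cod C \<eta>\<^bsub>A\<^esub> = obj A"
    "\<mu>\<^bsub>A\<^esub> \<in> Arr C" "Dom C \<mu>\<^bsub>A\<^esub> = obj A \<odot> obj A" "Cod C \<mu>\<^bsub>A\<^esub> = obj A"
  using assms unfolding algebra_def by (auto simp: in_homD)

lemma algebra_laws: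
  assumes "algebra C A"
  shows "\<mu>\<^bsub>A\<^esub> \<cdot> (\<eta>\<^bsub>A\<^esub> \<otimes> \<one> (obj A)) = \<one> (obj A)" "\<mu>\<^bsub>A\<^esub> \<cdot> (\<one> (obj A) \<otimes> \<eta>\<^bsub>A\<^esub>) = \<one> (obj A)"
    "\<mu>\<^bsub>A\<^esub> \<cdot> (\<mu>\<^bsub>A\<^esub> \<otimes> \<one> (obj A)) = \<mu>\<^bsub>A\<^esub> \<cdot> (\<one> (obj A) \<otimes> \<mu>\<^bsub>A\<^esub>)"
  using assms unfolding algebra_def by blast+

text \<open>The convolution product of morphisms from the coalgebra \<open>D\<close> to the algebra \<open>A\<close>.\<close>

definition conv where "conv D A f g = \<mu>\<^bsub>A\<^esub> \<cdot> (f \<otimes> g) \<cdot> \<delta>\<^bsub>D\<^esub>"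

context
  fixes D :: "('o, 'm, 'y) coalgebra_scheme" and A :: "('o, 'm, 'x) hopf_scheme"
  assumes D: "coalgebra C D" and A: "algebra C A"
begin

lemma conv_unit_left:
  assumes "f \<in> hom C (obj D) (obj A)"
  shows "conv D A (\<eta>\<^bsub>A\<^esub> \<cdot> \<epsilon>\<^bsub>D\<^esub>) f = f"
proof -
  note [simp] = coalgebraD[OF D] algebraD[OF A] in_homD[OF assms]
  have "conv D A (\<eta>\<^bsub>A\<^esub> \<cdot> \<epsilon>\<^bsub>D\<^esub>) f = (\<mu>\<^bsub>A\<^esub> \<cdot> (\<eta>\<^bsub>A\<^esub> \<otimes> \<one> (obj A))) \<cdot> (\<epsilon>\<^bsub>D\<^esub> \<otimes> f) \<cdot> \<delta>\<^bsub>D\<^esub>"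
    unfolding conv_def by (simp add: diag)
  also have "\<dots> = f \<cdot> (\<epsilon>\<^bsub>D\<^esub> \<otimes> \<one> (obj D)) \<cdot> \<delta>\<^bsub>D\<^esub>"
    by (simp add: algebra_laws[OF A] diag slide)
  finally show ?thesis by (simp add: coalgebra_laws[OF D] diag)
qed

lemma conv_unit_right:
  assumes "f \<in> hom C (obj D) (obj A)"
  shows "conv D A f (\<eta>\<^bsub>A\<^esub> \<cdot> \<epsilon>\<^bsub>D\<^esub>) = f"
proof -
  note [simp] = coalgebraD[OF D] algebraD[OF A] in_homD[OF assms]
  have "conv D A f (\<eta>\<^bsub>A\<^esub> \<cdot> \<epsilon>\<^bsub>D\<^esub>) = (\<mu>\<^bsub>A\<^esub> \<cdot> (\<one> (obj A) \<otimes> \<eta>\<^bsub>A\<^esub>)) \<cdot> (f \<otimes> \<epsilon>\<^bsub>D\<^esub>) \<cdot> \<delta>\<^bsub>D\<^esub>"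
    unfolding conv_def by (simp add: diag)
  also have "\<dots> = f \<cdot> (\<one> (obj D) \<otimes> \<epsilon>\<^bsub>D\<^esub>) \<cdot> \<delta>\<^bsub>D\<^esub>"
    by (simp add: algebra_laws[OF A] diag slide)
  finally show ?thesis by (simp add: coalgebra_laws[OF D] diag)
qed

lemma conv_assoc:
  assumes "f \<in> hom C (obj D) (obj A)" "g \<in> hom C (obj D) (obj A)" "h \<in> hom C (obj D) (obj A)"
  shows "conv D A (conv D A f g) h = conv D A f (conv D A g h)"
proof -
  note [simp] = coalgebraD[OF D] algebraD[OF A] in_homD[OF assms(1)] in_homD[OF assms(2)] in_homD[OF assms(3)]
  have "conv D A (conv D A f g) h =
      (\<mu>\<^bsub>A\<^esub> \<cdot> (\<mu>\<^bsub>A\<^esub> \<otimes> \<one> (obj A))) \<cdot> (f \<otimes> g \<otimes> h) \<cdot> (\<delta>\<^bsub>D\<^esub> \<otimes> \<one> (obj D)) \<cdot> \<delta>\<^bsub>D\<^esub>"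
    unfolding conv_def by (simp add: diag)
  also have "\<dots> = \<mu>\<^bsub>A\<^esub> \<cdot> (\<one> (obj A) \<otimes> \<mu>\<^bsub>A\<^esub>) \<cdot> (f \<otimes> g \<otimes> h) \<cdot> (\<one> (obj D) \<otimes> \<delta>\<^bsub>D\<^esub>) \<cdot> \<delta>\<^bsub>D\<^esub>"
    unfolding algebra_laws[OF A] coalgebra_laws[OF D] by (simp add: Cmp_assoc_arr)
  also have "\<dots> = conv D A f (conv D A g h)"
    unfolding conv_def by (simp add: diag)
  finally show ?thesis .
qed

lemma conv_inverse_unique:
  assumes "f \<in> hom C (obj D) (obj A)" "g \<in> hom C (obj D) (obj A)" "g' \<in> hom C (obj D) (obj A)"
    and "conv D A g f = \<eta>\<^bsub>A\<^esub> \<cdot> \<epsilon>\<^bsub>D\<^esub>" "conv D A f g' = \<eta>\<^bsub>A\<^esub> \<cdot> \<epsilon>\<^bsub>D\<^esub>"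
  shows "g = g'"
  using conv_assoc[OF assms(2,1,3)] assms(4,5) conv_unit_left[OF assms(3)] conv_unit_right[OF assms(2)]
  by simp

end

lemma coalgebra_morphismD:
  assumes "coalgebra_morphism C D E f"
  shows "f \<in> hom C (obj D) (obj E)" "\<epsilon>\<^bsub>E\<^esub> \<cdot> f = \<epsilon>\<^bsub>D\<^esub>" "\<delta>\<^bsub>E\<^esub> \<cdot> f = (f \<otimes> f) \<cdot> \<delta>\<^bsub>D\<^esub>"
  using assms unfolding coalgebra_morphism_def by auto

lemma conv_comp_coalgebra_morphism:
  assumes "coalgebra C D" "coalgebra C E" "algebra C A" "coalgebra_morphism C D E h"
    "f \<in> hom C (obj E) (obj A)" "g \<in> hom C (obj E) (obj A)"
  shows "conv E A f g \<cdot> h = conv D A (f \<cdot> h) (g \<cdot> h)"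
proof -
  note [simp] = coalgebraD[OF assms(1)] coalgebraD[OF assms(2)] algebraD[OF assms(3)]
     in_homD[OF assms(5)] in_homD[OF assms(6)] in_homD[OF coalgebra_morphismD(1)[OF assms(4)]]
  have "conv E A f g \<cdot> h = \<mu>\<^bsub>A\<^esub> \<cdot> (f \<otimes> g) \<cdot> \<delta>\<^bsub>E\<^esub> \<cdot> h"
    unfolding conv_def by (simp add: diag)
  then show ?thesis
    unfolding conv_def coalgebra_morphismD(3)[OF assms(4)] by (simp add: diag)
qed

lemma coalgebra_morphism_comp:
  assumes "coalgebra C D" "coalgebra C E" "coalgebra C F"
    "coalgebra_morphism C D E f" "coalgebra_morphism C E F g"
  shows "coalgebra_morphism C D F (g \<cdot> f)"
proof -
  note [simp] = coalgebraD[OF assms(1)] coalgebraD[OF assms(2)] coalgebraD[OF assms(3)]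
     in_homD[OF coalgebra_morphismD(1)[OF assms(4)]] in_homD[OF coalgebra_morphismD(1)[OF assms(5)]]
  have "\<epsilon>\<^bsub>F\<^esub> \<cdot> g \<cdot> f = (\<epsilon>\<^bsub>F\<^esub> \<cdot> g) \<cdot> f" "\<delta>\<^bsub>F\<^esub> \<cdot> g \<cdot> f = (\<delta>\<^bsub>F\<^esub> \<cdot> g) \<cdot> f"
    by (simp_all add: Cmp_assoc_arr)
  moreover have "((g \<otimes> g) \<cdot> \<delta>\<^bsub>E\<^esub>) \<cdot> f = (g \<otimes> g) \<cdot> \<delta>\<^bsub>E\<^esub> \<cdot> f" by (simp add: Cmp_assoc_arr)
  ultimately show ?thesis
    unfolding coalgebra_morphism_def
    by (simp add: coalgebra_morphismD[OF assms(4)] coalgebra_morphismD[OF assms(5)] in_homI diag)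
qed

section \<open>Tensor products of coalgebras and of algebras\<close>

lemma tensor_coalgebra_sel [simp]:
  "obj (tensor_coalgebra C D E) = obj D \<odot> obj E"
  "\<epsilon>\<^bsub>tensor_coalgebra C D E\<^esub> = \<epsilon>\<^bsub>D\<^esub> \<otimes> \<epsilon>\<^bsub>E\<^esub>"
  "\<delta>\<^bsub>tensor_coalgebra C D E\<^esub> = (\<one> (obj D) \<otimes> \<c> (obj D) (obj E) \<otimes> \<one> (obj E)) \<cdot> (\<delta>\<^bsub>D\<^esub> \<otimes> \<delta>\<^bsub>E\<^esub>)"
  unfolding tensor_coalgebra_def by simp_all

lemma tensor_coalgebra_assoc:
  assumes "coalgebra C D" "coalgebra C E" "coalgebra C F"
  shows "tensor_coalgebra C (tensor_coalgebra C D E) F = tensor_coalgebra C D (tensor_coalgebra C E F)"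
proof -
  note [simp] = coalgebraD[OF assms(1)] coalgebraD[OF assms(2)] coalgebraD[OF assms(3)]
  let ?D = "obj D" and ?E = "obj E" and ?F = "obj F"
  have "\<delta>\<^bsub>tensor_coalgebra C (tensor_coalgebra C D E) F\<^esub> =
     (\<one> ?D \<otimes> \<one> ?E \<otimes> \<c> ?D ?F \<otimes> \<one> ?E \<otimes> \<one> ?F) \<cdot> (\<one> ?D \<otimes> \<c> ?D ?E \<otimes> \<c> ?E ?F \<otimes> \<one> ?F) \<cdot> (\<delta>\<^bsub>D\<^esub> \<otimes> \<delta>\<^bsub>E\<^esub> \<otimes> \<delta>\<^bsub>F\<^esub>)"
    by (simp add: Braid_TenO_left layers) (simp add: diag)
  also have "\<one> ?D \<otimes> \<c> ?D ?E \<otimes> \<c> ?E ?F \<otimes> \<one> ?F =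
      (\<one> ?D \<otimes> \<c> ?D ?E \<otimes> \<one> ?F \<otimes> \<one> ?E \<otimes> \<one> ?F) \<cdot> (\<one> ?D \<otimes> \<one> ?D \<otimes> \<one> ?E \<otimes> \<c> ?E ?F \<otimes> \<one> ?F)"
    by (simp add: diag)
  also have "(\<one> ?D \<otimes> \<one> ?E \<otimes> \<c> ?D ?F \<otimes> \<one> ?E \<otimes> \<one> ?F) \<cdot> \<dots> \<cdot> (\<delta>\<^bsub>D\<^esub> \<otimes> \<delta>\<^bsub>E\<^esub> \<otimes> \<delta>\<^bsub>F\<^esub>)
      = \<delta>\<^bsub>tensor_coalgebra C D (tensor_coalgebra C E F)\<^esub>"
    by (simp add: Braid_TenO_right layers)
  finally show ?thesis
    unfolding tensor_coalgebra_def by (simp add: TenM_assoc)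
qed

lemma tensor_coalgebra_morphism:
  assumes "coalgebra C D" "coalgebra C E" "coalgebra C D'" "coalgebra C E'"
    and "coalgebra_morphism C D D' f" "coalgebra_morphism C E E' g"
  shows "coalgebra_morphism C (tensor_coalgebra C D E) (tensor_coalgebra C D' E') (f \<otimes> g)"
proof -
  note [simp] = coalgebraD[OF assms(1)] coalgebraD[OF assms(2)] coalgebraD[OF assms(3)] coalgebraD[OF
      assms(4)]
     in_homD[OF coalgebra_morphismD(1)[OF assms(5)]] in_homD[OF coalgebra_morphismD(1)[OF assms(6)]]
  note f = coalgebra_morphismD[OF assms(5)] and g = coalgebra_morphismD[OF assms(6)]
  let ?D = "obj D" and ?E = "obj E" and ?D' = "obj D'" and ?E' = "obj E'"
  have "(\<delta>\<^bsub>D'\<^esub> \<otimes> \<delta>\<^bsub>E'\<^esub>) \<cdot> (f \<otimes> g) = (f \<otimes> f \<otimes> g \<otimes> g) \<cdot> (\<delta>\<^bsub>D\<^esub> \<otimes> \<delta>\<^bsub>E\<^esub>)"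
    using f g by (simp add: diag)
  moreover have "(\<one> ?D' \<otimes> \<c> ?D' ?E' \<otimes> \<one> ?E') \<cdot> (f \<otimes> f \<otimes> g \<otimes> g)
      = (f \<otimes> g \<otimes> f \<otimes> g) \<cdot> (\<one> ?D \<otimes> \<c> ?D ?E \<otimes> \<one> ?E)"
    by (simp add: Braid_nat diag)
  ultimately have "(\<one> ?D' \<otimes> \<c> ?D' ?E' \<otimes> \<one> ?E') \<cdot> (\<delta>\<^bsub>D'\<^esub> \<otimes> \<delta>\<^bsub>E'\<^esub>) \<cdot> (f \<otimes> g)
      = (f \<otimes> g \<otimes> f \<otimes> g) \<cdot> (\<one> ?D \<otimes> \<c> ?D ?E \<otimes> \<one> ?E) \<cdot> (\<delta>\<^bsub>D\<^esub> \<otimes> \<delta>\<^bsub>E\<^esub>)"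
    by (simp add: Cmp_assoc_arr[symmetric])
  then show ?thesis
    unfolding coalgebra_morphism_def by (simp add: f(2) g(2) in_homI interchange Cmp_assoc_arr TenM_assoc)
qed

lemma tensor_coalgebra:
  assumes "coalgebra C D" "coalgebra C E"
  shows "coalgebra C (tensor_coalgebra C D E)"
proof -
  note [simp] = coalgebraD[OF assms(1)] coalgebraD[OF assms(2)]
  let ?D = "obj D" and ?E = "obj E"
  let ?c = "\<one> ?D \<otimes> \<c> ?D ?E \<otimes> \<one> ?E"
  have cl: "((\<epsilon>\<^bsub>D\<^esub> \<otimes> \<epsilon>\<^bsub>E\<^esub>) \<otimes> \<one> ?D \<otimes> \<one> ?E) \<cdot> ?c \<cdot> (\<delta>\<^bsub>D\<^esub> \<otimes> \<delta>\<^bsub>E\<^esub>) = \<one> ?D \<otimes> \<one> ?E"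
  proof -
    have "((\<epsilon>\<^bsub>D\<^esub> \<otimes> \<epsilon>\<^bsub>E\<^esub>) \<otimes> \<one> ?D \<otimes> \<one> ?E) \<cdot> ?c = \<epsilon>\<^bsub>D\<^esub> \<otimes> (\<c> ?D \<K> \<cdot> (\<one> ?D \<otimes> \<epsilon>\<^bsub>E\<^esub>)) \<otimes> \<one> ?E"
      by (simp add: Braid_nat diag)
    also have "\<dots> = (\<epsilon>\<^bsub>D\<^esub> \<otimes> \<one> ?D) \<otimes> (\<epsilon>\<^bsub>E\<^esub> \<otimes> \<one> ?E)"
      by (simp add: Braid_unit_right diag)
    finally have "((\<epsilon>\<^bsub>D\<^esub> \<otimes> \<epsilon>\<^bsub>E\<^esub>) \<otimes> \<one> ?D \<otimes> \<one> ?E) \<cdot> ?c \<cdot> (\<delta>\<^bsub>D\<^esub> \<otimes> \<delta>\<^bsub>E\<^esub>)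
       = ((\<epsilon>\<^bsub>D\<^esub> \<otimes> \<one> ?D) \<otimes> (\<epsilon>\<^bsub>E\<^esub> \<otimes> \<one> ?E)) \<cdot> (\<delta>\<^bsub>D\<^esub> \<otimes> \<delta>\<^bsub>E\<^esub>)" by (simp add: Cmp_assoc_arr[symmetric])
    then show ?thesis by (simp add: interchange coalgebra_laws[OF assms(1)] coalgebra_laws[OF assms(2)])
  qed
  have cr: "(\<one> ?D \<otimes> \<one> ?E \<otimes> \<epsilon>\<^bsub>D\<^esub> \<otimes> \<epsilon>\<^bsub>E\<^esub>) \<cdot> ?c \<cdot> (\<delta>\<^bsub>D\<^esub> \<otimes> \<delta>\<^bsub>E\<^esub>) = \<one> ?D \<otimes> \<one> ?E"
  proof -
    have "(\<one> ?D \<otimes> \<one> ?E \<otimes> \<epsilon>\<^bsub>D\<^esub> \<otimes> \<epsilon>\<^bsub>E\<^esub>) \<cdot> ?c = \<one> ?D \<otimes> (\<c> \<K> ?E \<cdot> (\<epsilon>\<^bsub>D\<^esub> \<otimes> \<one> ?E)) \<otimes> \<epsilon>\<^bsub>E\<^esub>"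
      by (simp add: Braid_nat diag)
    also have "\<dots> = (\<one> ?D \<otimes> \<epsilon>\<^bsub>D\<^esub>) \<otimes> (\<one> ?E \<otimes> \<epsilon>\<^bsub>E\<^esub>)"
      by (simp add: Braid_unit_left diag)
    finally have "(\<one> ?D \<otimes> \<one> ?E \<otimes> \<epsilon>\<^bsub>D\<^esub> \<otimes> \<epsilon>\<^bsub>E\<^esub>) \<cdot> ?c \<cdot> (\<delta>\<^bsub>D\<^esub> \<otimes> \<delta>\<^bsub>E\<^esub>)
       = ((\<one> ?D \<otimes> \<epsilon>\<^bsub>D\<^esub>) \<otimes> (\<one> ?E \<otimes> \<epsilon>\<^bsub>E\<^esub>)) \<cdot> (\<delta>\<^bsub>D\<^esub> \<otimes> \<delta>\<^bsub>E\<^esub>)" by (simp add: Cmp_assoc_arr[symmetric])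
    then show ?thesis by (simp add: interchange coalgebra_laws[OF assms(1)] coalgebra_laws[OF assms(2)])
  qed
  have coass: "(?c \<cdot> (\<delta>\<^bsub>D\<^esub> \<otimes> \<delta>\<^bsub>E\<^esub>)) \<otimes> \<one> (?D \<odot> ?E) \<cdot> ?c \<cdot> (\<delta>\<^bsub>D\<^esub> \<otimes> \<delta>\<^bsub>E\<^esub>) =
     \<one> (?D \<odot> ?E) \<otimes> (?c \<cdot> (\<delta>\<^bsub>D\<^esub> \<otimes> \<delta>\<^bsub>E\<^esub>)) \<cdot> ?c \<cdot> (\<delta>\<^bsub>D\<^esub> \<otimes> \<delta>\<^bsub>E\<^esub>)"
  proof -
    \<comment> \<open>By naturality of the braiding both sides become a triple coproduct of each factor followed
      by a permutation built from braidings; the two permutations agree by the hexagon axioms.\<close>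
    have "((\<delta>\<^bsub>D\<^esub> \<otimes> \<delta>\<^bsub>E\<^esub>) \<otimes> \<one> ?D \<otimes> \<one> ?E) \<cdot> ?c =
       \<delta>\<^bsub>D\<^esub> \<otimes> (\<c> ?D (?E \<odot> ?E) \<cdot> (\<one> ?D \<otimes> \<delta>\<^bsub>E\<^esub>)) \<otimes> \<one> ?E"
      by (simp add: Braid_nat diag)
    also have "\<dots> = (\<one> ?D \<otimes> \<one> ?D \<otimes> \<c> ?D (?E \<odot> ?E) \<otimes> \<one> ?E) \<cdot> ((\<delta>\<^bsub>D\<^esub> \<otimes> \<one> ?D) \<otimes> (\<delta>\<^bsub>E\<^esub> \<otimes> \<one> ?E))"
      by (simp add: diag)
    finally have L: "((\<delta>\<^bsub>D\<^esub> \<otimes> \<delta>\<^bsub>E\<^esub>) \<otimes> \<one> ?D \<otimes> \<one> ?E) \<cdot> ?c =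
        (\<one> ?D \<otimes> \<one> ?D \<otimes> \<c> ?D (?E \<odot> ?E) \<otimes> \<one> ?E) \<cdot> ((\<delta>\<^bsub>D\<^esub> \<otimes> \<one> ?D) \<otimes> (\<delta>\<^bsub>E\<^esub> \<otimes> \<one> ?E))" .
    have "(\<one> ?D \<otimes> \<one> ?E \<otimes> (\<delta>\<^bsub>D\<^esub> \<otimes> \<delta>\<^bsub>E\<^esub>)) \<cdot> ?c =
       \<one> ?D \<otimes> (\<c> (?D \<odot> ?D) ?E \<cdot> (\<delta>\<^bsub>D\<^esub> \<otimes> \<one> ?E)) \<otimes> \<delta>\<^bsub>E\<^esub>"
      by (simp add: Braid_nat diag)
    also have "\<dots> = (\<one> ?D \<otimes> \<c> (?D \<odot> ?D) ?E \<otimes> \<one> ?E \<otimes> \<one> ?E) \<cdot> ((\<one> ?D \<otimes> \<delta>\<^bsub>D\<^esub>) \<otimes> (\<one> ?E \<otimes> \<delta>\<^bsub>E\<^esub>))"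
      by (simp add: diag)
    finally have R: "(\<one> ?D \<otimes> \<one> ?E \<otimes> (\<delta>\<^bsub>D\<^esub> \<otimes> \<delta>\<^bsub>E\<^esub>)) \<cdot> ?c =
        (\<one> ?D \<otimes> \<c> (?D \<odot> ?D) ?E \<otimes> \<one> ?E \<otimes> \<one> ?E) \<cdot> ((\<one> ?D \<otimes> \<delta>\<^bsub>D\<^esub>) \<otimes> (\<one> ?E \<otimes> \<delta>\<^bsub>E\<^esub>))" .
    have far: "(\<one> ?D \<otimes> \<c> ?D ?E \<otimes> \<one> ?E \<otimes> \<one> ?D \<otimes> \<one> ?E) \<cdot> (\<one> ?D \<otimes> \<one> ?D \<otimes> \<one> ?E \<otimes> \<c> ?D ?E \<otimes> \<one> ?E)
        = \<one> ?D \<otimes> \<c> ?D ?E \<otimes> \<c> ?D ?E \<otimes> \<one> ?E"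
      by (simp add: diag)
    have "(?c \<otimes> \<one> ?D \<otimes> \<one> ?E) \<cdot> (\<one> ?D \<otimes> \<one> ?D \<otimes> \<c> ?D (?E \<odot> ?E) \<otimes> \<one> ?E) =
       (\<one> ?D \<otimes> \<c> ?D ?E \<otimes> \<c> ?D ?E \<otimes> \<one> ?E) \<cdot> (\<one> ?D \<otimes> \<one> ?D \<otimes> \<c> ?D ?E \<otimes> \<one> ?E \<otimes> \<one> ?E)"
      using Cmp_chain[OF far, of "\<one> ?D \<otimes> \<one> ?D \<otimes> \<c> ?D ?E \<otimes> \<one> ?E \<otimes> \<one> ?E"]
      by (simp add: Braid_TenO_right layers)
    also have "\<dots> = (\<one> ?D \<otimes> \<one> ?E \<otimes> ?c) \<cdot> (\<one> ?D \<otimes> \<c> (?D \<odot> ?D) ?E \<otimes> \<one> ?E \<otimes> \<one> ?E)"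
      by (simp add: Braid_TenO_left layers) (simp add: diag)
    finally have perm: "(?c \<otimes> \<one> ?D \<otimes> \<one> ?E) \<cdot> (\<one> ?D \<otimes> \<one> ?D \<otimes> \<c> ?D (?E \<odot> ?E) \<otimes> \<one> ?E) =
       (\<one> ?D \<otimes> \<one> ?E \<otimes> ?c) \<cdot> (\<one> ?D \<otimes> \<c> (?D \<odot> ?D) ?E \<otimes> \<one> ?E \<otimes> \<one> ?E)" .
    have "(?c \<cdot> (\<delta>\<^bsub>D\<^esub> \<otimes> \<delta>\<^bsub>E\<^esub>)) \<otimes> \<one> (?D \<odot> ?E) \<cdot> ?c \<cdot> (\<delta>\<^bsub>D\<^esub> \<otimes> \<delta>\<^bsub>E\<^esub>) =
       (?c \<otimes> \<one> ?D \<otimes> \<one> ?E) \<cdot> (\<one> ?D \<otimes> \<one> ?D \<otimes> \<c> ?D (?E \<odot> ?E) \<otimes> \<one> ?E) \<cdot> ((\<delta>\<^bsub>D\<^esub> \<otimes> \<one> ?D) \<otimes> (\<delta>\<^bsub>E\<^esub> \<otimes> \<one> ?E))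
          \<cdot> (\<delta>\<^bsub>D\<^esub> \<otimes> \<delta>\<^bsub>E\<^esub>)"
      using Cmp_chain[OF L, of "\<delta>\<^bsub>D\<^esub> \<otimes> \<delta>\<^bsub>E\<^esub>"] by (simp add: layers)
    also have "\<dots> = (?c \<otimes> \<one> ?D \<otimes> \<one> ?E) \<cdot> (\<one> ?D \<otimes> \<one> ?D \<otimes> \<c> ?D (?E \<odot> ?E) \<otimes> \<one> ?E)
        \<cdot> ((\<one> ?D \<otimes> \<delta>\<^bsub>D\<^esub>) \<otimes> (\<one> ?E \<otimes> \<delta>\<^bsub>E\<^esub>)) \<cdot> (\<delta>\<^bsub>D\<^esub> \<otimes> \<delta>\<^bsub>E\<^esub>)"
      by (simp add: interchange coalgebra_laws[OF assms(1)] coalgebra_laws[OF assms(2)])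
    also have "\<dots> = (\<one> ?D \<otimes> \<one> ?E \<otimes> ?c) \<cdot> (\<one> ?D \<otimes> \<c> (?D \<odot> ?D) ?E \<otimes> \<one> ?E \<otimes> \<one> ?E)
        \<cdot> ((\<one> ?D \<otimes> \<delta>\<^bsub>D\<^esub>) \<otimes> (\<one> ?E \<otimes> \<delta>\<^bsub>E\<^esub>)) \<cdot> (\<delta>\<^bsub>D\<^esub> \<otimes> \<delta>\<^bsub>E\<^esub>)"
      using Cmp_chain[OF perm, of "((\<one> ?D \<otimes> \<delta>\<^bsub>D\<^esub>) \<otimes> (\<one> ?E \<otimes> \<delta>\<^bsub>E\<^esub>)) \<cdot> (\<delta>\<^bsub>D\<^esub> \<otimes> \<delta>\<^bsub>E\<^esub>)"]
          by (simp add: Cmp_assoc_arr)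
    also have "\<dots> = \<one> (?D \<odot> ?E) \<otimes> (?c \<cdot> (\<delta>\<^bsub>D\<^esub> \<otimes> \<delta>\<^bsub>E\<^esub>)) \<cdot> ?c \<cdot> (\<delta>\<^bsub>D\<^esub> \<otimes> \<delta>\<^bsub>E\<^esub>)"
      using Cmp_chain[OF R, of "\<delta>\<^bsub>D\<^esub> \<otimes> \<delta>\<^bsub>E\<^esub>"] by (simp add: layers)
    finally show ?thesis .
  qed
  show ?thesis
    unfolding coalgebra_def
  proof (intro conjI)
    show "(\<epsilon>\<^bsub>tensor_coalgebra C D E\<^esub> \<otimes> \<one> (obj (tensor_coalgebra C D E))) \<cdot> \<delta>\<^bsub>tensor_coalgebra C D E\<^esub>
      = \<one> (obj (tensor_coalgebra C D E))"
      using cl by (simp add: Ident_TenO)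
    show "(\<one> (obj (tensor_coalgebra C D E)) \<otimes> \<epsilon>\<^bsub>tensor_coalgebra C D E\<^esub>) \<cdot> \<delta>\<^bsub>tensor_coalgebra C D E\<^esub>
      = \<one> (obj (tensor_coalgebra C D E))"
      using cr by (simp add: Ident_TenO TenM_assoc)
  qed (simp_all add: in_homI coass)
qed

text \<open>Cocommutativity makes the coproduct a coalgebra morphism; only \<open>\<c> \<cdot> \<delta> = \<delta>\<close> is used, and the
  braiding need not be an involution.\<close>

lemma cocommutative_comult_morphism:
  assumes D: "coalgebra C D" and co: "cocommutative C D"
  shows "coalgebra_morphism C D (tensor_coalgebra C D D) \<delta>\<^bsub>D\<^esub>"
proof -
  note [simp] = coalgebraD[OF D]
  let ?D = "obj D"
  have c: "\<c> ?D ?D \<cdot> \<delta>\<^bsub>D\<^esub> = \<delta>\<^bsub>D\<^esub>" using co unfolding cocommutative_def .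
  have "(\<delta>\<^bsub>D\<^esub> \<otimes> \<delta>\<^bsub>D\<^esub>) \<cdot> \<delta>\<^bsub>D\<^esub> = (\<one> (?D \<odot> ?D) \<otimes> \<delta>\<^bsub>D\<^esub>) \<cdot> (\<delta>\<^bsub>D\<^esub> \<otimes> \<one> ?D) \<cdot> \<delta>\<^bsub>D\<^esub>"
    by (simp add: diag)
  also have "\<dots> = (\<one> ?D \<otimes> ((\<one> ?D \<otimes> \<delta>\<^bsub>D\<^esub>) \<cdot> \<delta>\<^bsub>D\<^esub>)) \<cdot> \<delta>\<^bsub>D\<^esub>"
    by (simp add: coalgebra_laws[OF D] diag)
  also have "\<dots> = (\<one> ?D \<otimes> ((\<delta>\<^bsub>D\<^esub> \<otimes> \<one> ?D) \<cdot> \<delta>\<^bsub>D\<^esub>)) \<cdot> \<delta>\<^bsub>D\<^esub>"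
    by (simp add: coalgebra_laws(3)[OF D])
  finally have e: "(\<delta>\<^bsub>D\<^esub> \<otimes> \<delta>\<^bsub>D\<^esub>) \<cdot> \<delta>\<^bsub>D\<^esub> = (\<one> ?D \<otimes> ((\<delta>\<^bsub>D\<^esub> \<otimes> \<one> ?D) \<cdot> \<delta>\<^bsub>D\<^esub>)) \<cdot> \<delta>\<^bsub>D\<^esub>" .
  have "(\<one> ?D \<otimes> \<c> ?D ?D \<otimes> \<one> ?D) \<cdot> (\<delta>\<^bsub>D\<^esub> \<otimes> \<delta>\<^bsub>D\<^esub>) \<cdot> \<delta>\<^bsub>D\<^esub> = (\<one> ?D \<otimes> (((\<c> ?D ?D \<cdot> \<delta>\<^bsub>D\<^esub>) \<otimes> \<one> ?D) \<cdot> \<delta>\<^bsub>D\<^esub>)) \<cdot> \<delta>\<^bsub>D\<^esub>"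
    unfolding e by (simp add: diag)
  also have "\<dots> = (\<delta>\<^bsub>D\<^esub> \<otimes> \<delta>\<^bsub>D\<^esub>) \<cdot> \<delta>\<^bsub>D\<^esub>" unfolding c e ..
  finally have "(\<one> ?D \<otimes> \<c> ?D ?D \<otimes> \<one> ?D) \<cdot> (\<delta>\<^bsub>D\<^esub> \<otimes> \<delta>\<^bsub>D\<^esub>) \<cdot> \<delta>\<^bsub>D\<^esub> = (\<delta>\<^bsub>D\<^esub> \<otimes> \<delta>\<^bsub>D\<^esub>) \<cdot> \<delta>\<^bsub>D\<^esub>" .
  moreover have "(\<epsilon>\<^bsub>D\<^esub> \<otimes> \<epsilon>\<^bsub>D\<^esub>) \<cdot> \<delta>\<^bsub>D\<^esub> = \<epsilon>\<^bsub>D\<^esub> \<cdot> (\<one> ?D \<otimes> \<epsilon>\<^bsub>D\<^esub>) \<cdot> \<delta>\<^bsub>D\<^esub>"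
    by (simp add: diag slide)
  ultimately show ?thesis
    unfolding coalgebra_morphism_def by (simp add: in_homI diag coalgebra_laws[OF D])
qed

text \<open>
  The tensor product of the data of two Hopf algebras. Only its algebra structure is studied; the
  coalgebra operations and the antipode, taken componentwise, are there to fill the record.
\<close>

definition tensor_hopf where
  "tensor_hopf A B = \<lparr>obj = obj A \<odot> obj B, counit = \<epsilon>\<^bsub>A\<^esub> \<otimes> \<epsilon>\<^bsub>B\<^esub>,
     comult = \<delta>\<^bsub>tensor_coalgebra C A B\<^esub>, unit = \<eta>\<^bsub>A\<^esub> \<otimes> \<eta>\<^bsub>B\<^esub>,
     mult = (\<mu>\<^bsub>A\<^esub> \<otimes> \<mu>\<^bsub>B\<^esub>) \<cdot> (\<one> (obj A) \<otimes> \<c> (obj B) (obj A) \<otimes> \<one> (obj B)),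
     antipode = antipode A \<otimes> antipode B\<rparr>"

lemma tensor_algebra:
  assumes "algebra C A" "algebra C B"
  shows "algebra C (tensor_hopf A B)"
proof -
  note [simp] = algebraD[OF assms(1)] algebraD[OF assms(2)]
  let ?A = "obj A" and ?B = "obj B" and ?m = "\<mu>\<^bsub>A\<^esub>" and ?n = "\<mu>\<^bsub>B\<^esub>"
  let ?c = "\<one> ?A \<otimes> \<c> ?B ?A \<otimes> \<one> ?B"
  have ul: "((?m \<otimes> ?n) \<cdot> ?c) \<cdot> ((\<eta>\<^bsub>A\<^esub> \<otimes> \<eta>\<^bsub>B\<^esub>) \<otimes> \<one> ?A \<otimes> \<one> ?B) = \<one> ?A \<otimes> \<one> ?B"
  proof -
    have "?c \<cdot> ((\<eta>\<^bsub>A\<^esub> \<otimes> \<eta>\<^bsub>B\<^esub>) \<otimes> \<one> ?A \<otimes> \<one> ?B) = \<eta>\<^bsub>A\<^esub> \<otimes> (\<c> ?B ?A \<cdot> (\<eta>\<^bsub>B\<^esub> \<otimes> \<one> ?A)) \<otimes> \<one> ?B"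
      by (simp add: Braid_nat diag)
    also have "\<dots> = (\<eta>\<^bsub>A\<^esub> \<otimes> \<one> ?A) \<otimes> (\<eta>\<^bsub>B\<^esub> \<otimes> \<one> ?B)"
      by (simp add: Braid_nat Braid_unit_left diag)
    finally show ?thesis by (simp add: Cmp_assoc_arr interchange algebra_laws[OF assms(1)]
        algebra_laws[OF assms(2)])
  qed
  have ur: "((?m \<otimes> ?n) \<cdot> ?c) \<cdot> (\<one> ?A \<otimes> \<one> ?B \<otimes> \<eta>\<^bsub>A\<^esub> \<otimes> \<eta>\<^bsub>B\<^esub>) = \<one> ?A \<otimes> \<one> ?B"
  proof -
    have "?c \<cdot> (\<one> ?A \<otimes> \<one> ?B \<otimes> \<eta>\<^bsub>A\<^esub> \<otimes> \<eta>\<^bsub>B\<^esub>) = \<one> ?A \<otimes> (\<c> ?B ?A \<cdot> (\<one> ?B \<otimes> \<eta>\<^bsub>A\<^esub>)) \<otimes> \<eta>\<^bsub>B\<^esub>"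
      by (simp add: Braid_nat diag)
    also have "\<dots> = (\<one> ?A \<otimes> \<eta>\<^bsub>A\<^esub>) \<otimes> (\<one> ?B \<otimes> \<eta>\<^bsub>B\<^esub>)"
      by (simp add: Braid_nat Braid_unit_right diag)
    finally show ?thesis by (simp add: Cmp_assoc_arr interchange algebra_laws[OF assms(1)]
        algebra_laws[OF assms(2)])
  qed
  have as: "((?m \<otimes> ?n) \<cdot> ?c) \<cdot> (((?m \<otimes> ?n) \<cdot> ?c) \<otimes> \<one> (?A \<odot> ?B)) =
     ((?m \<otimes> ?n) \<cdot> ?c) \<cdot> (\<one> (?A \<odot> ?B) \<otimes> ((?m \<otimes> ?n) \<cdot> ?c))"
  proof -
    have "?c \<cdot> (?m \<otimes> ?n \<otimes> \<one> ?A \<otimes> \<one> ?B) = ?m \<otimes> (\<c> ?B ?A \<cdot> (?n \<otimes> \<one> ?A)) \<otimes> \<one> ?B"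
      by (simp add: Braid_nat diag)
    also have "\<dots> = ((?m \<otimes> \<one> ?A) \<otimes> (?n \<otimes> \<one> ?B)) \<cdot> (\<one> ?A \<otimes> \<one> ?A \<otimes> \<c> (?B \<odot> ?B) ?A \<otimes> \<one> ?B)"
      by (simp add: Braid_nat diag)
    finally have L: "?c \<cdot> (?m \<otimes> ?n \<otimes> \<one> ?A \<otimes> \<one> ?B) =
       ((?m \<otimes> \<one> ?A) \<otimes> (?n \<otimes> \<one> ?B)) \<cdot> (\<one> ?A \<otimes> \<one> ?A \<otimes> \<c> (?B \<odot> ?B) ?A \<otimes> \<one> ?B)" .
    have "?c \<cdot> (\<one> ?A \<otimes> \<one> ?B \<otimes> ?m \<otimes> ?n) = \<one> ?A \<otimes> (\<c> ?B ?A \<cdot> (\<one> ?B \<otimes> ?m)) \<otimes> ?n"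
      by (simp add: Braid_nat diag)
    also have "\<dots> = ((\<one> ?A \<otimes> ?m) \<otimes> (\<one> ?B \<otimes> ?n)) \<cdot> (\<one> ?A \<otimes> \<c> ?B (?A \<odot> ?A) \<otimes> \<one> ?B \<otimes> \<one> ?B)"
      by (simp add: Braid_nat diag)
    finally have R: "?c \<cdot> (\<one> ?A \<otimes> \<one> ?B \<otimes> ?m \<otimes> ?n) =
       ((\<one> ?A \<otimes> ?m) \<otimes> (\<one> ?B \<otimes> ?n)) \<cdot> (\<one> ?A \<otimes> \<c> ?B (?A \<odot> ?A) \<otimes> \<one> ?B \<otimes> \<one> ?B)" .
    have far: "(\<one> ?A \<otimes> \<one> ?A \<otimes> \<one> ?B \<otimes> \<c> ?B ?A \<otimes> \<one> ?B) \<cdot> (\<one> ?A \<otimes> \<c> ?B ?A \<otimes> \<one> ?B \<otimes> \<one> ?A \<otimes> \<one> ?B)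
        = (\<one> ?A \<otimes> \<c> ?B ?A \<otimes> \<one> ?A \<otimes> \<one> ?B \<otimes> \<one> ?B) \<cdot> (\<one> ?A \<otimes> \<one> ?B \<otimes> \<one> ?A \<otimes> \<c> ?B ?A \<otimes> \<one> ?B)"
      by (simp add: diag)
    have perm: "(\<one> ?A \<otimes> \<one> ?A \<otimes> \<c> (?B \<odot> ?B) ?A \<otimes> \<one> ?B) \<cdot> (?c \<otimes> \<one> ?A \<otimes> \<one> ?B) =
      (\<one> ?A \<otimes> \<c> ?B (?A \<odot> ?A) \<otimes> \<one> ?B \<otimes> \<one> ?B) \<cdot> (\<one> ?A \<otimes> \<one> ?B \<otimes> ?c)"
      using far by (simp add: Braid_TenO_left Braid_TenO_right layers)
    have "((?m \<otimes> ?n) \<cdot> ?c) \<cdot> (((?m \<otimes> ?n) \<cdot> ?c) \<otimes> \<one> (?A \<odot> ?B)) =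
      (?m \<otimes> ?n) \<cdot> ((?m \<otimes> \<one> ?A) \<otimes> (?n \<otimes> \<one> ?B)) \<cdot> (\<one> ?A \<otimes> \<one> ?A \<otimes> \<c> (?B \<odot> ?B) ?A \<otimes> \<one> ?B) \<cdot> (?c \<otimes> \<one> ?A \<otimes> \<one> ?B)"
      using Cmp_chain[OF L, of "?c \<otimes> \<one> ?A \<otimes> \<one> ?B"] by (simp add: layers)
    also have "\<dots> = ((?m \<cdot> (?m \<otimes> \<one> ?A)) \<otimes> (?n \<cdot> (?n \<otimes> \<one> ?B))) \<cdot> (\<one> ?A \<otimes> \<c> ?B (?A \<odot> ?A) \<otimes> \<one> ?B \<otimes> \<one> ?B)
        \<cdot> (\<one> ?A \<otimes> \<one> ?B \<otimes> ?c)"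
      unfolding perm by (simp add: interchange_chain)
    also have "\<dots> = (?m \<otimes> ?n) \<cdot> ((\<one> ?A \<otimes> ?m) \<otimes> (\<one> ?B \<otimes> ?n)) \<cdot> (\<one> ?A \<otimes> \<c> ?B (?A \<odot> ?A) \<otimes> \<one> ?B \<otimes> \<one> ?B)
        \<cdot> (\<one> ?A \<otimes> \<one> ?B \<otimes> ?c)"
      unfolding algebra_laws[OF assms(1)] algebra_laws[OF assms(2)] by (simp add: interchange_chain)
    also have "\<dots> = ((?m \<otimes> ?n) \<cdot> ?c) \<cdot> (\<one> (?A \<odot> ?B) \<otimes> ((?m \<otimes> ?n) \<cdot> ?c))"
      using Cmp_chain[OF R, of "\<one> ?A \<otimes> \<one> ?B \<otimes> ?c"] by (simp add: layers)
    finally show ?thesis .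
  qed
  show ?thesis
    unfolding algebra_def tensor_hopf_def
    using ul ur as by (simp add: in_homI Ident_TenO TenM_assoc)
qed

section \<open>Cocommutative Hopf algebras\<close>

lemma hopf_algebraD:
  assumes "hopf_algebra C H"
  shows "algebra C H" "coalgebra C H" "antipode H \<in> hom C (obj H) (obj H)"
    "\<epsilon>\<^bsub>H\<^esub> \<cdot> \<eta>\<^bsub>H\<^esub> = \<one> \<K>" "\<delta>\<^bsub>H\<^esub> \<cdot> \<eta>\<^bsub>H\<^esub> = \<eta>\<^bsub>H\<^esub> \<otimes> \<eta>\<^bsub>H\<^esub>"
    "coalgebra_morphism C (tensor_coalgebra C H H) H \<mu>\<^bsub>H\<^esub>"
    "conv H H (\<one> (obj H)) (antipode H) = \<eta>\<^bsub>H\<^esub> \<cdot> \<epsilon>\<^bsub>H\<^esub>"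
    "conv H H (antipode H) (\<one> (obj H)) = \<eta>\<^bsub>H\<^esub> \<cdot> \<epsilon>\<^bsub>H\<^esub>"
proof -
  show "algebra C H" and c: "coalgebra C H" using assms by (auto simp: hopf_algebra_def bialgebra_def)
  have "\<eta>\<^bsub>H\<^esub> \<in> hom C \<K> (obj H)" using assms by (auto simp: hopf_algebra_def bialgebra_def algebra_def)
  then show "\<delta>\<^bsub>H\<^esub> \<cdot> \<eta>\<^bsub>H\<^esub> = \<eta>\<^bsub>H\<^esub> \<otimes> \<eta>\<^bsub>H\<^esub>"
    using assms by (simp add: hopf_algebra_def bialgebra_def coalgebra_morphism_def unit_coalgebra_def
        in_homD Cmp_one_right)
qed (use assms in \<open>auto simp: hopf_algebra_def bialgebra_def coalgebra_morphism_def unit_coalgebra_def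
    conv_def\<close>)

text \<open>
  For the comultiplicativity of the antipode \<open>\<lambda>\<close>, both \<open>\<delta> \<cdot> \<lambda>\<close> and \<open>(\<lambda> \<otimes> \<lambda>) \<cdot> \<delta>\<close> are convolution
  inverse to \<open>\<delta>\<close>, as morphisms from \<open>H\<close> to the algebra \<open>H \<odot> H\<close>.
\<close>

lemma cocommutative_antipode_coalgebra_morphism:
  assumes H: "hopf_algebra C H" and co: "cocommutative C H"
  shows "coalgebra_morphism C H H (antipode H)"
proof -
  note HD = hopf_algebraD[OF H]
  note [simp] = coalgebraD[OF HD(2)] algebraD[OF HD(1)] in_homD[OF HD(3)]
  let ?H = "obj H" and ?s = "antipode H" and ?T = "tensor_hopf H H"
  let ?c = "\<one> ?H \<otimes> \<c> ?H ?H \<otimes> \<one> ?H"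
  note TA = tensor_algebra[OF HD(1) HD(1)]
  note \<mu> = coalgebra_morphismD[OF HD(6)] and \<delta> = coalgebra_morphismD[OF cocommutative_comult_morphism[OF
      HD(2) co]]
  have T: "obj ?T = ?H \<odot> ?H" "\<mu>\<^bsub>?T\<^esub> = (\<mu>\<^bsub>H\<^esub> \<otimes> \<mu>\<^bsub>H\<^esub>) \<cdot> ?c" "\<eta>\<^bsub>?T\<^esub>
      = \<eta>\<^bsub>H\<^esub> \<otimes> \<eta>\<^bsub>H\<^esub>" by (simp_all add: tensor_hopf_def)
  have m: "\<delta>\<^bsub>H\<^esub> \<cdot> \<mu>\<^bsub>H\<^esub> = \<mu>\<^bsub>?T\<^esub> \<cdot> (\<delta>\<^bsub>H\<^esub> \<otimes> \<delta>\<^bsub>H\<^esub>)"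
    using \<mu>(3) by (simp add: T Cmp_assoc_arr)
  have 1: "conv H ?T (\<delta>\<^bsub>H\<^esub> \<cdot> ?s) \<delta>\<^bsub>H\<^esub> = \<eta>\<^bsub>?T\<^esub> \<cdot> \<epsilon>\<^bsub>H\<^esub>"
  proof -
    have "conv H ?T (\<delta>\<^bsub>H\<^esub> \<cdot> ?s) \<delta>\<^bsub>H\<^esub> = (\<mu>\<^bsub>?T\<^esub> \<cdot> (\<delta>\<^bsub>H\<^esub> \<otimes> \<delta>\<^bsub>H\<^esub>)) \<cdot> (?s \<otimes> \<one> ?H) \<cdot> \<delta>\<^bsub>H\<^esub>"
      by (simp add: conv_def algebraD[OF TA] T(1) diag)
    also have "\<dots> = \<delta>\<^bsub>H\<^esub> \<cdot> conv H H ?s (\<one> ?H)"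
      unfolding m[symmetric] by (simp add: conv_def Cmp_assoc_arr)
    also have "\<dots> = (\<delta>\<^bsub>H\<^esub> \<cdot> \<eta>\<^bsub>H\<^esub>) \<cdot> \<epsilon>\<^bsub>H\<^esub>" by (simp add: HD(8) Cmp_assoc_arr)
    finally show ?thesis by (simp add: HD(5) T)
  qed
  have 2: "conv H ?T \<delta>\<^bsub>H\<^esub> ((?s \<otimes> ?s) \<cdot> \<delta>\<^bsub>H\<^esub>) = \<eta>\<^bsub>?T\<^esub> \<cdot> \<epsilon>\<^bsub>H\<^esub>"
  proof -
    have "?c \<cdot> (\<one> ?H \<otimes> \<one> ?H \<otimes> ?s \<otimes> ?s) = (\<one> ?H \<otimes> ?s \<otimes> \<one> ?H \<otimes> ?s) \<cdot> ?c"
      by (simp add: Braid_nat diag)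
    then have "conv H ?T \<delta>\<^bsub>H\<^esub> ((?s \<otimes> ?s) \<cdot> \<delta>\<^bsub>H\<^esub>) =
      (\<mu>\<^bsub>H\<^esub> \<otimes> \<mu>\<^bsub>H\<^esub>) \<cdot> (\<one> ?H \<otimes> ?s \<otimes> \<one> ?H \<otimes> ?s) \<cdot> ?c \<cdot> (\<delta>\<^bsub>H\<^esub> \<otimes> \<delta>\<^bsub>H\<^esub>) \<cdot> \<delta>\<^bsub>H\<^esub>"
      using Cmp_chain[of ?c "\<one> ?H \<otimes> \<one> ?H \<otimes> ?s \<otimes> ?s" "(\<one> ?H \<otimes> ?s \<otimes> \<one> ?H \<otimes> ?s) \<cdot> ?c" "(\<delta>\<^bsub>H\<^esub> \<otimes> \<delta>\<^bsub>H\<^esub>) \<cdot> \<delta>\<^bsub>H\<^esub>"]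
      by (simp add: conv_def T layers)
    also have "?c \<cdot> (\<delta>\<^bsub>H\<^esub> \<otimes> \<delta>\<^bsub>H\<^esub>) \<cdot> \<delta>\<^bsub>H\<^esub> = (\<delta>\<^bsub>H\<^esub> \<otimes> \<delta>\<^bsub>H\<^esub>) \<cdot> \<delta>\<^bsub>H\<^esub>"
      using \<delta>(3) by (simp add: Cmp_assoc_arr)
    also have "(\<mu>\<^bsub>H\<^esub> \<otimes> \<mu>\<^bsub>H\<^esub>) \<cdot> (\<one> ?H \<otimes> ?s \<otimes> \<one> ?H \<otimes> ?s) \<cdot> \<dots> = (conv H H (\<one> ?H) ?s \<otimes> conv H H (\<one> ?H) ?s) \<cdot> \<delta>\<^bsub>H\<^esub>"
      unfolding conv_def by (simp add: diag)
    also have "\<dots> = (\<eta>\<^bsub>H\<^esub> \<otimes> \<eta>\<^bsub>H\<^esub>) \<cdot> (\<epsilon>\<^bsub>H\<^esub> \<otimes> \<epsilon>\<^bsub>H\<^esub>) \<cdot> \<delta>\<^bsub>H\<^esub>"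
      unfolding HD(7) by (simp add: interchange_chain)
    also have "(\<epsilon>\<^bsub>H\<^esub> \<otimes> \<epsilon>\<^bsub>H\<^esub>) \<cdot> \<delta>\<^bsub>H\<^esub> = \<epsilon>\<^bsub>H\<^esub>" using \<delta>(2) by simp
    finally show ?thesis by (simp add: T)
  qed
  have d: "\<delta>\<^bsub>H\<^esub> \<cdot> ?s = (?s \<otimes> ?s) \<cdot> \<delta>\<^bsub>H\<^esub>"
    by (rule conv_inverse_unique[OF HD(2) TA _ _ _ 1 2]) (simp_all add: in_homI T)
  have "\<epsilon>\<^bsub>H\<^esub> \<cdot> conv H H (\<one> ?H) ?s = (\<epsilon>\<^bsub>H\<^esub> \<cdot> \<mu>\<^bsub>H\<^esub>) \<cdot> (\<one> ?H \<otimes> ?s) \<cdot> \<delta>\<^bsub>H\<^esub>"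
    by (simp add: conv_def Cmp_assoc_arr)
  also have "\<dots> = (\<epsilon>\<^bsub>H\<^esub> \<cdot> ?s) \<cdot> (\<epsilon>\<^bsub>H\<^esub> \<otimes> \<one> ?H) \<cdot> \<delta>\<^bsub>H\<^esub>"
    using \<mu>(2) by (simp add: diag slide)
  also have "\<dots> = \<epsilon>\<^bsub>H\<^esub> \<cdot> ?s" by (simp add: coalgebra_laws[OF HD(2)] diag)
  finally have "\<epsilon>\<^bsub>H\<^esub> \<cdot> ?s = \<epsilon>\<^bsub>H\<^esub> \<cdot> \<eta>\<^bsub>H\<^esub> \<cdot> \<epsilon>\<^bsub>H\<^esub>" by (simp add: HD(7))
  also have "\<dots> = (\<epsilon>\<^bsub>H\<^esub> \<cdot> \<eta>\<^bsub>H\<^esub>) \<cdot> \<epsilon>\<^bsub>H\<^esub>" by (simp add: Cmp_assoc_arr)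
  finally have "\<epsilon>\<^bsub>H\<^esub> \<cdot> ?s = \<epsilon>\<^bsub>H\<^esub>" by (simp add: HD(4) Cmp_one_left)
  then show ?thesis unfolding coalgebra_morphism_def using d HD(3) by simp
qed

text \<open>
  Precomposing \<open>x\<^sub>1 s(x\<^sub>2) = \<epsilon>(x)\<close> with \<open>s\<close> shows that \<open>s \<cdot> s\<close> is a right inverse of \<open>s\<close>; since the
  identity is a left inverse of \<open>s\<close>, the two agree.
\<close>

lemma right_antipode_imp_left_antipode:
  assumes A: "algebra C H" and D: "coalgebra C H"
    and \<eta>: "\<epsilon>\<^bsub>H\<^esub> \<cdot> \<eta>\<^bsub>H\<^esub> = \<one> \<K>"
    and s: "coalgebra_morphism C H H s" and r: "conv H H (\<one> (obj H)) s = \<eta>\<^bsub>H\<^esub> \<cdot> \<epsilon>\<^bsub>H\<^esub>"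
  shows "conv H H s (\<one> (obj H)) = \<eta>\<^bsub>H\<^esub> \<cdot> \<epsilon>\<^bsub>H\<^esub>"
proof -
  note [simp] = coalgebraD[OF D] algebraD[OF A] in_homD[OF coalgebra_morphismD(1)[OF s]]
  note s' = coalgebra_morphismD[OF s]
  have id: "\<one> (obj H) \<in> hom C (obj H) (obj H)" by (simp add: in_homI)
  have "conv H H s (s \<cdot> s) = conv H H (\<one> (obj H)) s \<cdot> s"
    using conv_comp_coalgebra_morphism[OF D D A s id s'(1)] by (simp add: Cmp_one_left)
  also have "\<dots> = \<eta>\<^bsub>H\<^esub> \<cdot> \<epsilon>\<^bsub>H\<^esub>" unfolding r by (simp add: Cmp_assoc_arr s'(2))
  finally have ss: "conv H H s (s \<cdot> s) = \<eta>\<^bsub>H\<^esub> \<cdot> \<epsilon>\<^bsub>H\<^esub>" .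
  have "\<one> (obj H) = s \<cdot> s"
    by (rule conv_inverse_unique[OF D A s'(1) id _ r ss]) (simp add: in_homI)
  with ss show ?thesis by simp
qed

text \<open>
  A coalgebra morphism \<open>f\<close> to a Hopf algebra has the convolution inverse \<open>antipode H \<cdot> f\<close>, so it can be
  cancelled when \<open>f\<close> is its own convolution square.
\<close>

lemma conv_idempotent_coalgebra_morphism:
  assumes H: "hopf_algebra C H" and D: "coalgebra C D"
    and f: "coalgebra_morphism C D H f" and i: "conv D H f f = f"
  shows "f = \<eta>\<^bsub>H\<^esub> \<cdot> \<epsilon>\<^bsub>D\<^esub>"
proof -
  note HD = hopf_algebraD[OF H]
  note [simp] = coalgebraD[OF HD(2)] coalgebraD[OF D] algebraD[OF HD(1)] in_homD[OF HD(3)]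
    in_homD[OF coalgebra_morphismD(1)[OF f]]
  let ?g = "antipode H \<cdot> f"
  have g: "?g \<in> hom C (obj D) (obj H)" by (simp add: in_homI)
  note f' = coalgebra_morphismD[OF f]
  have id: "\<one> (obj H) \<in> hom C (obj H) (obj H)" by (simp add: in_homI)
  have fg: "conv D H f ?g = \<eta>\<^bsub>H\<^esub> \<cdot> \<epsilon>\<^bsub>D\<^esub>"
    using conv_comp_coalgebra_morphism[OF D HD(2) HD(1) f id HD(3)]
    by (simp add: HD(7) f'(2) Cmp_one_left Cmp_assoc_arr)
  have "f = conv D H f (conv D H f ?g)"
    unfolding fg by (simp add: conv_unit_right[OF D HD(1) f'(1)])
  also have "\<dots> = conv D H (conv D H f f) ?g"
    by (rule conv_assoc[OF D HD(1) f'(1) f'(1) g, symmetric])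
  finally show ?thesis by (simp add: i fg)
qed

lemma coalgebra_morphism_Ident: "coalgebra C D \<Longrightarrow> coalgebra_morphism C D D (\<one> (obj D))"
  unfolding coalgebra_morphism_def
  by (simp add: coalgebraD in_homI Cmp_one_left Cmp_one_right TenM_Ident)

section \<open>Weak twisted post-Hopf algebras\<close>

context
  fixes H :: "('o, 'm, 'y) hopf_scheme" and m \<Phi> :: 'm
  assumes W: "weak_twisted_post_hopf_algebra C H m \<Phi>"
begin

lemma weakD:
  shows "hopf_algebra C H" "coalgebra_morphism C (tensor_coalgebra C H H) H m"
    "coalgebra_morphism C H H \<Phi>"
    "\<Phi> \<cdot> mu_bar C H m \<Phi> = \<mu>\<^bsub>H\<^esub> \<cdot> (\<Phi> \<otimes> m) \<cdot> (\<delta>\<^bsub>H\<^esub> \<otimes> \<Phi>)"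
    "m \<cdot> (\<one> (obj H) \<otimes> m) = m \<cdot> (mu_bar C H m \<Phi> \<otimes> \<one> (obj H))"
    "m \<cdot> (\<one> (obj H) \<otimes> \<mu>\<^bsub>H\<^esub>) = \<mu>\<^bsub>H\<^esub> \<cdot> (m \<otimes> m) \<cdot> (\<one> (obj H) \<otimes> \<c> (obj H) (obj H) \<otimes> \<one> (obj H))
         \<cdot> (\<delta>\<^bsub>H\<^esub> \<otimes> \<one> (obj H) \<otimes> \<one> (obj H))"
  using W unfolding weak_twisted_post_hopf_algebra_def mu_bar_def by blast+

lemmas HD = hopf_algebraD[OF weakD(1)]

lemma m_arr: "m \<in> Arr C" "Dom C m = obj H \<odot> obj H" "Cod C m = obj H"
  using in_homD[OF coalgebra_morphismD(1)[OF weakD(2)]] by simp_all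

lemma Phi_arr: "\<Phi> \<in> Arr C" "Dom C \<Phi> = obj H" "Cod C \<Phi> = obj H"
  using in_homD[OF coalgebra_morphismD(1)[OF weakD(3)]] by simp_all

lemmas arrs = coalgebraD[OF HD(2)] algebraD[OF HD(1)] in_homD[OF HD(3)] m_arr Phi_arr

lemma mu_bar_arr: "mu_bar C H m \<Phi> \<in> Arr C" "Dom C (mu_bar C H m \<Phi>) = obj H \<odot> obj H"
    "Cod C (mu_bar C H m \<Phi>) = obj H"
  unfolding mu_bar_def by (simp_all add: arrs)

text \<open>Multiplicativity of the action, applied to \<open>\<eta> \<eta> = \<eta>\<close>, makes \<open>x \<mapsto> x \<rhd> \<eta>\<close> idempotent for
  convolution.\<close>

lemma act_unit: "m \<cdot> (\<one> (obj H) \<otimes> \<eta>\<^bsub>H\<^esub>) = \<eta>\<^bsub>H\<^esub> \<cdot> \<epsilon>\<^bsub>H\<^esub>"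
proof (rule conv_idempotent_coalgebra_morphism[OF weakD(1) HD(2)])
  note [simp] = arrs
  let ?H = "obj H" and ?c = "\<one> (obj H) \<otimes> \<c> (obj H) (obj H) \<otimes> \<one> (obj H)"
  let ?f = "m \<cdot> (\<one> ?H \<otimes> \<eta>\<^bsub>H\<^esub>)"
  have c: "?c \<cdot> (\<one> ?H \<otimes> \<one> ?H \<otimes> \<eta>\<^bsub>H\<^esub> \<otimes> \<eta>\<^bsub>H\<^esub>) = \<one> ?H \<otimes> \<eta>\<^bsub>H\<^esub> \<otimes> \<one> ?H \<otimes> \<eta>\<^bsub>H\<^esub>"
    by (simp add: Braid_nat Braid_unit_right diag)
  have \<delta>\<eta>: "(\<delta>\<^bsub>H\<^esub> \<otimes> \<eta>\<^bsub>H\<^esub> \<otimes> \<eta>\<^bsub>H\<^esub>) = (\<one> ?H \<otimes> \<one> ?H \<otimes> \<eta>\<^bsub>H\<^esub> \<otimes> \<eta>\<^bsub>H\<^esub>) \<cdot> \<delta>\<^bsub>H\<^esub>"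
    using TenM_unit_dom[of "\<eta>\<^bsub>H\<^esub> \<otimes> \<eta>\<^bsub>H\<^esub>" "\<delta>\<^bsub>H\<^esub>"] by (simp add: Ident_TenO TenM_assoc)
  have "coalgebra_morphism C H (tensor_coalgebra C H H) (\<one> ?H \<otimes> \<eta>\<^bsub>H\<^esub>)"
  proof -
    have "(\<delta>\<^bsub>H\<^esub> \<otimes> \<delta>\<^bsub>H\<^esub>) \<cdot> (\<one> ?H \<otimes> \<eta>\<^bsub>H\<^esub>) = (\<one> ?H \<otimes> \<one> ?H \<otimes> \<eta>\<^bsub>H\<^esub> \<otimes> \<eta>\<^bsub>H\<^esub>) \<cdot> \<delta>\<^bsub>H\<^esub>"
      unfolding \<delta>\<eta>[symmetric] using HD(5) by (simp add: interchange Cmp_one_right)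
    then have "?c \<cdot> (\<delta>\<^bsub>H\<^esub> \<otimes> \<delta>\<^bsub>H\<^esub>) \<cdot> (\<one> ?H \<otimes> \<eta>\<^bsub>H\<^esub>) = (\<one> ?H \<otimes> \<eta>\<^bsub>H\<^esub> \<otimes> \<one> ?H \<otimes> \<eta>\<^bsub>H\<^esub>) \<cdot> \<delta>\<^bsub>H\<^esub>"
      using Cmp_chain[OF c, of "\<delta>\<^bsub>H\<^esub>"] by simp
    then show ?thesis
      unfolding coalgebra_morphism_def
      by (simp add: in_homI interchange HD(4) Cmp_one_right TenM_unit_right TenM_assoc Cmp_assoc_arr)
  qed
  then show "coalgebra_morphism C H H ?f"
    by (rule coalgebra_morphism_comp[OF HD(2) tensor_coalgebra[OF HD(2) HD(2)] HD(2) _ weakD(2)])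
  have "?f = m \<cdot> (\<one> ?H \<otimes> \<mu>\<^bsub>H\<^esub>) \<cdot> (\<one> ?H \<otimes> \<eta>\<^bsub>H\<^esub> \<otimes> \<eta>\<^bsub>H\<^esub>)"
  proof -
    have "\<mu>\<^bsub>H\<^esub> \<cdot> (\<eta>\<^bsub>H\<^esub> \<otimes> \<eta>\<^bsub>H\<^esub>) = (\<mu>\<^bsub>H\<^esub> \<cdot> (\<one> ?H \<otimes> \<eta>\<^bsub>H\<^esub>)) \<cdot> \<eta>\<^bsub>H\<^esub>"
      using TenM_unit_dom[of "\<eta>\<^bsub>H\<^esub>" "\<eta>\<^bsub>H\<^esub>"] by (simp add: Cmp_assoc_arr)
    then show ?thesis by (simp add: algebra_laws[OF HD(1)] diag)
  qed
  also have "\<dots> = \<mu>\<^bsub>H\<^esub> \<cdot> (m \<otimes> m) \<cdot> ?c \<cdot> (\<delta>\<^bsub>H\<^esub> \<otimes> \<one> ?H \<otimes> \<one> ?H) \<cdot> (\<one> ?H \<otimes> \<eta>\<^bsub>H\<^esub> \<otimes> \<eta>\<^bsub>H\<^esub>)"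
    using Cmp_chain[OF weakD(6), of "\<one> ?H \<otimes> \<eta>\<^bsub>H\<^esub> \<otimes> \<eta>\<^bsub>H\<^esub>"] by (simp add: Cmp_assoc_arr)
  also have "(\<delta>\<^bsub>H\<^esub> \<otimes> \<one> ?H \<otimes> \<one> ?H) \<cdot> (\<one> ?H \<otimes> \<eta>\<^bsub>H\<^esub> \<otimes> \<eta>\<^bsub>H\<^esub>) = (\<one> ?H \<otimes> \<one> ?H \<otimes> \<eta>\<^bsub>H\<^esub> \<otimes> \<eta>\<^bsub>H\<^esub>) \<cdot> \<delta>\<^bsub>H\<^esub>"
    unfolding \<delta>\<eta>[symmetric] by (simp add: diag)
  also have "?c \<cdot> \<dots> = (\<one> ?H \<otimes> \<eta>\<^bsub>H\<^esub> \<otimes> \<one> ?H \<otimes> \<eta>\<^bsub>H\<^esub>) \<cdot> \<delta>\<^bsub>H\<^esub>"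
    using Cmp_chain[OF c, of "\<delta>\<^bsub>H\<^esub>"] by simp
  also have "\<mu>\<^bsub>H\<^esub> \<cdot> (m \<otimes> m) \<cdot> \<dots> = conv H H ?f ?f"
    unfolding conv_def by (simp add: diag)
  finally show "conv H H ?f ?f = ?f" by simp
qed

lemma mu_bar_unit_right: "mu_bar C H m \<Phi> \<cdot> (\<one> (obj H) \<otimes> \<eta>\<^bsub>H\<^esub>) = \<Phi>"
proof -
  note [simp] = arrs
  have "(\<delta>\<^bsub>H\<^esub> \<otimes> \<one> (obj H)) \<cdot> (\<one> (obj H) \<otimes> \<eta>\<^bsub>H\<^esub>) = (\<one> (obj H) \<otimes> \<one> (obj H) \<otimes> \<eta>\<^bsub>H\<^esub>) \<cdot> \<delta>\<^bsub>H\<^esub>"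
    using TenM_unit_dom[of "\<eta>\<^bsub>H\<^esub>" "\<delta>\<^bsub>H\<^esub>"] by (simp add: Ident_TenO interchange TenM_assoc Cmp_one_left
        Cmp_one_right)
  then have "mu_bar C H m \<Phi> \<cdot> (\<one> (obj H) \<otimes> \<eta>\<^bsub>H\<^esub>) = conv H H \<Phi> (m \<cdot> (\<one> (obj H) \<otimes> \<eta>\<^bsub>H\<^esub>))"
    unfolding mu_bar_def conv_def by (simp add: Cmp_assoc_arr) (simp add: diag)
  also have "\<dots> = \<Phi>"
    unfolding act_unit by (rule conv_unit_right[OF HD(2) HD(1)]) (simp add: in_homI)
  finally show ?thesis .
qed

lemma Phi_mu_bar: "\<Phi> \<cdot> mu_bar C H m \<Phi> = mu_bar C H m \<Phi> \<cdot> (\<one> (obj H) \<otimes> \<Phi>)"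
  by (subst weakD(4)) (simp add: mu_bar_def arrs diag)

lemma mu_bar_coalgebra_morphism:
  assumes co: "cocommutative C H"
  shows "coalgebra_morphism C (tensor_coalgebra C H H) H (mu_bar C H m \<Phi>)"
proof -
  note T = tensor_coalgebra[OF HD(2) HD(2)]
  note T3 = tensor_coalgebra[OF T HD(2)]
  have "coalgebra_morphism C (tensor_coalgebra C H H) (tensor_coalgebra C (tensor_coalgebra C H H) H)
     (\<delta>\<^bsub>H\<^esub> \<otimes> \<one> (obj H))"
    by (rule tensor_coalgebra_morphism[OF HD(2) HD(2) T HD(2)
       cocommutative_comult_morphism[OF HD(2) co] coalgebra_morphism_Ident[OF HD(2)]])
  moreover have "coalgebra_morphism C (tensor_coalgebra C (tensor_coalgebra C H H) H)
     (tensor_coalgebra C H H) (\<Phi> \<otimes> m)"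
    unfolding tensor_coalgebra_assoc[OF HD(2) HD(2) HD(2)]
    by (rule tensor_coalgebra_morphism[OF HD(2) T HD(2) HD(2) weakD(3) weakD(2)])
  ultimately have "coalgebra_morphism C (tensor_coalgebra C H H) (tensor_coalgebra C H H) ((\<Phi> \<otimes> m)
      \<cdot> (\<delta>\<^bsub>H\<^esub> \<otimes> \<one> (obj H)))"
    by (rule coalgebra_morphism_comp[OF T T3 T])
  then show ?thesis
    unfolding mu_bar_def by (rule coalgebra_morphism_comp[OF T T HD(2) _ HD(6)])
qed

text \<open>
  With \<open>?R\<close> producing \<open>x\<^sub>1, x\<^sub>2, y\<^sub>1, x\<^sub>3, y\<^sub>2, z\<close> out of \<open>x, y, z\<close>, both sides are equal to
  \<open>\<Phi> x\<^sub>1 (x\<^sub>2 \<rhd> \<Phi> y\<^sub>1) (x\<^sub>3 \<rhd> (y\<^sub>2 \<rhd> z))\<close>.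
\<close>

lemma mu_bar_assoc:
  assumes co: "cocommutative C H"
  shows "mu_bar C H m \<Phi> \<cdot> (mu_bar C H m \<Phi> \<otimes> \<one> (obj H)) = mu_bar C H m \<Phi> \<cdot> (\<one> (obj H) \<otimes> mu_bar C H m \<Phi>)"
proof -
  note [simp] = arrs mu_bar_arr
  let ?H = "obj H" and ?c = "\<one> (obj H) \<otimes> \<c> (obj H) (obj H) \<otimes> \<one> (obj H)" and ?M = "mu_bar C H m \<Phi>"
  note M\<delta> = coalgebra_morphismD(3)[OF mu_bar_coalgebra_morphism[OF co], simplified]
  let ?R = "(\<one> ?H \<otimes> ?c \<otimes> \<one> ?H) \<cdot> (((\<delta>\<^bsub>H\<^esub> \<otimes> \<one> ?H) \<cdot> \<delta>\<^bsub>H\<^esub>) \<otimes> \<delta>\<^bsub>H\<^esub> \<otimes> \<one> ?H)"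
  have "?M \<cdot> (?M \<otimes> \<one> ?H) = \<mu>\<^bsub>H\<^esub> \<cdot> (\<Phi> \<otimes> m) \<cdot> ((\<delta>\<^bsub>H\<^esub> \<cdot> ?M) \<otimes> \<one> ?H)"
    by (subst (1) mu_bar_def) (simp add: diag)
  also have "\<dots> = \<mu>\<^bsub>H\<^esub> \<cdot> ((\<Phi> \<cdot> ?M) \<otimes> (m \<cdot> (?M \<otimes> \<one> ?H))) \<cdot> ((?c \<cdot> (\<delta>\<^bsub>H\<^esub> \<otimes> \<delta>\<^bsub>H\<^esub>)) \<otimes> \<one> ?H)"
    unfolding M\<delta> by (simp add: layers) (simp add: diag)
  also have "\<dots> = \<mu>\<^bsub>H\<^esub> \<cdot> ((?M \<cdot> (\<one> ?H \<otimes> \<Phi>)) \<otimes> (m \<cdot> (\<one> ?H \<otimes> m))) \<cdot> ((?c \<cdot> (\<delta>\<^bsub>H\<^esub> \<otimes> \<delta>\<^bsub>H\<^esub>)) \<otimes> \<one> ?H)"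
    unfolding Phi_mu_bar weakD(5) ..
  also have "\<dots> = (\<mu>\<^bsub>H\<^esub> \<cdot> (\<mu>\<^bsub>H\<^esub> \<otimes> \<one> ?H)) \<cdot> (\<Phi> \<otimes> (m \<cdot> (\<one> ?H \<otimes> \<Phi>)) \<otimes> (m \<cdot> (\<one> ?H \<otimes> m))) \<cdot> ?R"
  proof -
    have 1: "(?M \<cdot> (\<one> ?H \<otimes> \<Phi>)) \<otimes> (m \<cdot> (\<one> ?H \<otimes> m)) =
      (\<mu>\<^bsub>H\<^esub> \<otimes> \<one> ?H) \<cdot> (\<Phi> \<otimes> (m \<cdot> (\<one> ?H \<otimes> \<Phi>)) \<otimes> (m \<cdot> (\<one> ?H \<otimes> m))) \<cdot> (\<delta>\<^bsub>H\<^esub> \<otimes> \<one> ?H \<otimes> \<one> ?H \<otimes> \<one> ?H \<otimes> \<one> ?H)"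
    proof -
      have e: "\<Phi> \<otimes> (m \<cdot> (\<one> ?H \<otimes> \<Phi>)) = (\<Phi> \<otimes> m) \<cdot> (\<one> ?H \<otimes> \<one> ?H \<otimes> \<Phi>)"
        by (simp add: diag)
      have "?M \<cdot> (\<one> ?H \<otimes> \<Phi>) = \<mu>\<^bsub>H\<^esub> \<cdot> (\<Phi> \<otimes> (m \<cdot> (\<one> ?H \<otimes> \<Phi>))) \<cdot> (\<delta>\<^bsub>H\<^esub> \<otimes> \<one> ?H)"
        unfolding e mu_bar_def by (simp add: Cmp_assoc_arr) (simp add: diag)
      then show ?thesis
        using interchange[of "\<delta>\<^bsub>H\<^esub> \<otimes> \<one> ?H" "\<one> ?H \<otimes> \<one> ?H \<otimes> \<one> ?H" "\<Phi> \<otimes> (m \<cdot> (\<one> ?H \<otimes> \<Phi>))" "m \<cdot> (\<one> ?H \<otimes> m)"]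
          interchange[of "(\<Phi> \<otimes> (m \<cdot> (\<one> ?H \<otimes> \<Phi>))) \<cdot> (\<delta>\<^bsub>H\<^esub> \<otimes> \<one> ?H)" "m \<cdot> (\<one> ?H \<otimes> m)" "\<mu>\<^bsub>H\<^esub>" "\<one> ?H"]
        by (simp add: TenM_assoc Ident_TenM_right Cmp_one_left)
    qed
    have "(\<delta>\<^bsub>H\<^esub> \<otimes> \<one> ?H \<otimes> \<one> ?H \<otimes> \<one> ?H \<otimes> \<one> ?H) \<cdot> (?c \<otimes> \<one> ?H)
        = (\<one> ?H \<otimes> ?c \<otimes> \<one> ?H) \<cdot> (\<delta>\<^bsub>H\<^esub> \<otimes> \<one> ?H \<otimes> \<one> ?H \<otimes> \<one> ?H \<otimes> \<one> ?H)"
      by (simp add: diag)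
    from Cmp_chain[OF this, of "\<delta>\<^bsub>H\<^esub> \<otimes> \<delta>\<^bsub>H\<^esub> \<otimes> \<one> ?H"]
    have 2: "(\<delta>\<^bsub>H\<^esub> \<otimes> \<one> ?H \<otimes> \<one> ?H \<otimes> \<one> ?H \<otimes> \<one> ?H) \<cdot> ((?c \<cdot> (\<delta>\<^bsub>H\<^esub> \<otimes> \<delta>\<^bsub>H\<^esub>)) \<otimes> \<one> ?H) = ?R"
      by (simp add: layers)
    have "\<mu>\<^bsub>H\<^esub> \<cdot> ((?M \<cdot> (\<one> ?H \<otimes> \<Phi>)) \<otimes> (m \<cdot> (\<one> ?H \<otimes> m))) \<cdot> ((?c \<cdot> (\<delta>\<^bsub>H\<^esub> \<otimes> \<delta>\<^bsub>H\<^esub>)) \<otimes> \<one> ?H) =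
      \<mu>\<^bsub>H\<^esub> \<cdot> (\<mu>\<^bsub>H\<^esub> \<otimes> \<one> ?H) \<cdot> (\<Phi> \<otimes> (m \<cdot> (\<one> ?H \<otimes> \<Phi>)) \<otimes> (m \<cdot> (\<one> ?H \<otimes> m))) \<cdot>
        (\<delta>\<^bsub>H\<^esub> \<otimes> \<one> ?H \<otimes> \<one> ?H \<otimes> \<one> ?H \<otimes> \<one> ?H) \<cdot> ((?c \<cdot> (\<delta>\<^bsub>H\<^esub> \<otimes> \<delta>\<^bsub>H\<^esub>)) \<otimes> \<one> ?H)"
      unfolding 1 by (simp add: Cmp_assoc_arr)
    then show ?thesis unfolding 2 by (simp add: Cmp_assoc_arr)
  qed
  also have "\<dots> = \<mu>\<^bsub>H\<^esub> \<cdot> (\<Phi> \<otimes> (\<mu>\<^bsub>H\<^esub> \<cdot> (m \<otimes> m) \<cdot> (\<one> ?H \<otimes> \<Phi> \<otimes> \<one> ?H \<otimes> m))) \<cdot> ?R"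
    unfolding algebra_laws[OF HD(1)] by (simp add: diag)
  also have "\<dots> = \<mu>\<^bsub>H\<^esub> \<cdot> (\<Phi> \<otimes> (m \<cdot> (\<one> ?H \<otimes> \<mu>\<^bsub>H\<^esub>))) \<cdot> (\<one> ?H \<otimes> \<one> ?H \<otimes> \<Phi> \<otimes> m) \<cdot> (\<delta>\<^bsub>H\<^esub> \<otimes> \<delta>\<^bsub>H\<^esub> \<otimes> \<one> ?H)"
  proof -
    have c: "?c \<cdot> (\<one> ?H \<otimes> \<one> ?H \<otimes> \<Phi> \<otimes> m) = (\<one> ?H \<otimes> \<Phi> \<otimes> \<one> ?H \<otimes> m) \<cdot> (?c \<otimes> \<one> ?H)"
      by (simp add: Braid_nat diag)
    have d: "(\<one> ?H \<otimes> \<delta>\<^bsub>H\<^esub> \<otimes> \<one> ?H \<otimes> \<one> ?H) \<cdot> (\<one> ?H \<otimes> \<one> ?H \<otimes> \<Phi> \<otimes> m) \<cdot> (\<delta>\<^bsub>H\<^esub> \<otimes> \<delta>\<^bsub>H\<^esub> \<otimes> \<one> ?H) =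
      (\<one> ?H \<otimes> \<one> ?H \<otimes> \<one> ?H \<otimes> \<Phi> \<otimes> m) \<cdot> (((\<delta>\<^bsub>H\<^esub> \<otimes> \<one> ?H) \<cdot> \<delta>\<^bsub>H\<^esub>) \<otimes> \<delta>\<^bsub>H\<^esub> \<otimes> \<one> ?H)"
      unfolding coalgebra_laws[OF HD(2)] by (simp add: diag)
    have "(\<Phi> \<otimes> (m \<cdot> (\<one> ?H \<otimes> \<mu>\<^bsub>H\<^esub>))) \<cdot> (\<one> ?H \<otimes> \<one> ?H \<otimes> \<Phi> \<otimes> m) \<cdot> (\<delta>\<^bsub>H\<^esub> \<otimes> \<delta>\<^bsub>H\<^esub> \<otimes> \<one> ?H) =
      (\<Phi> \<otimes> (\<mu>\<^bsub>H\<^esub> \<cdot> (m \<otimes> m))) \<cdot> (\<one> ?H \<otimes> ?c) \<cdot>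
      (\<one> ?H \<otimes> \<delta>\<^bsub>H\<^esub> \<otimes> \<one> ?H \<otimes> \<one> ?H) \<cdot> (\<one> ?H \<otimes> \<one> ?H \<otimes> \<Phi> \<otimes> m) \<cdot> (\<delta>\<^bsub>H\<^esub> \<otimes> \<delta>\<^bsub>H\<^esub> \<otimes> \<one> ?H)"
    proof -
      have "\<Phi> \<otimes> (m \<cdot> (\<one> ?H \<otimes> \<mu>\<^bsub>H\<^esub>)) = (\<Phi> \<otimes> (\<mu>\<^bsub>H\<^esub> \<cdot> (m \<otimes> m))) \<cdot> (\<one> ?H \<otimes> (?c \<cdot> (\<delta>\<^bsub>H\<^esub> \<otimes> \<one> ?H \<otimes> \<one> ?H)))"
        unfolding weakD(6) by (simp add: interchange Cmp_one_right Cmp_assoc_arr)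
      then show ?thesis by (simp add: layers)
    qed
    also have "\<dots> = (\<Phi> \<otimes> (\<mu>\<^bsub>H\<^esub> \<cdot> (m \<otimes> m))) \<cdot> (\<one> ?H \<otimes> (?c \<cdot> (\<one> ?H \<otimes> \<one> ?H \<otimes> \<Phi> \<otimes> m))) \<cdot> (((\<delta>\<^bsub>H\<^esub> \<otimes> \<one> ?H)
        \<cdot> \<delta>\<^bsub>H\<^esub>) \<otimes> \<delta>\<^bsub>H\<^esub> \<otimes> \<one> ?H)"
      unfolding d by (simp add: layers)
    also have "\<dots> = (\<Phi> \<otimes> (\<mu>\<^bsub>H\<^esub> \<cdot> (m \<otimes> m) \<cdot> (\<one> ?H \<otimes> \<Phi> \<otimes> \<one> ?H \<otimes> m))) \<cdot> ?R"
      using interchange[of "\<one> ?H" "?c \<otimes> \<one> ?H" \<Phi> "\<mu>\<^bsub>H\<^esub> \<cdot> (m \<otimes> m) \<cdot> (\<one> ?H \<otimes> \<Phi> \<otimes> \<one> ?H \<otimes> m)"]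
        interchange[of "\<one> ?H" "(\<one> ?H \<otimes> \<Phi> \<otimes> \<one> ?H \<otimes> m) \<cdot> (?c \<otimes> \<one> ?H)" \<Phi> "\<mu>\<^bsub>H\<^esub> \<cdot> (m \<otimes> m)"]
      unfolding c by (simp add: Cmp_assoc_arr[symmetric] TenM_assoc)
    finally show ?thesis by simp
  qed
  also have "\<dots> = ?M \<cdot> (\<one> ?H \<otimes> ?M)"
  proof -
    have "\<Phi> \<otimes> (m \<cdot> (\<one> ?H \<otimes> \<mu>\<^bsub>H\<^esub>)) = (\<Phi> \<otimes> m) \<cdot> (\<one> ?H \<otimes> \<one> ?H \<otimes> \<mu>\<^bsub>H\<^esub>)"
      by (simp add: diag)
    moreover have "(\<one> ?H \<otimes> \<one> ?H \<otimes> \<mu>\<^bsub>H\<^esub>) \<cdot> (\<one> ?H \<otimes> \<one> ?H \<otimes> \<Phi> \<otimes> m) \<cdot> (\<delta>\<^bsub>H\<^esub> \<otimes> \<delta>\<^bsub>H\<^esub> \<otimes> \<one> ?H)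
        = (\<delta>\<^bsub>H\<^esub> \<otimes> \<one> ?H) \<cdot> (\<one> ?H \<otimes> ?M)"
      unfolding mu_bar_def by (simp add: diag)
    ultimately show ?thesis
      by (subst mu_bar_def) (simp add: Cmp_assoc_arr)
  qed
  finally show ?thesis .
qed

end

section \<open>The convolution inverse of the action\<close>

text \<open>
  \<open>beta_tilde C H b f\<close> evaluates the \<open>Hs\<close>-leg of \<open>f\<close> at an additional first argument. Under this
  passage, the convolution inverse relation turns into a relation between morphisms from \<open>H \<odot> H\<close>
  to \<open>H\<close> in which the dual object no longer occurs.
\<close>

lemma beta_tilde_conv:
  assumes D: "coalgebra C H" and twisted_finite: "finite_via C (obj H) Hs a b"
    and f: "f \<in> hom C (obj H) (Hs \<odot> obj H)" and g: "g \<in> hom C (obj H) (Hs \<odot> obj H)"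
    and e: "(\<one> Hs \<otimes> b \<otimes> \<one> (obj H)) \<cdot> (f \<otimes> g) \<cdot> \<delta>\<^bsub>H\<^esub> = \<epsilon>\<^bsub>H\<^esub> \<otimes> a"
  shows "beta_tilde C H b g \<cdot> (beta_tilde C H b f \<otimes> \<one> (obj H)) \<cdot> (\<one> (obj H) \<otimes> \<delta>\<^bsub>H\<^esub>) = \<one> (obj H) \<otimes> \<epsilon>\<^bsub>H\<^esub>"
proof -
  let ?H = "obj H"
  have ab: "Hs \<in> Obj C" "a \<in> Arr C" "Dom C a = \<K>" "Cod C a = Hs \<odot> ?H" "b \<in> Arr C"
    "Dom C b = ?H \<odot> Hs" "Cod C b = \<K>"
    "(b \<otimes> \<one> ?H) \<cdot> (\<one> ?H \<otimes> a) = \<one> ?H"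
    using twisted_finite unfolding finite_via_def by (auto simp: in_homD)
  note [simp] = coalgebraD[OF D] ab(1-7) in_homD[OF f] in_homD[OF g]
  have "beta_tilde C H b g \<cdot> (beta_tilde C H b f \<otimes> \<one> ?H) \<cdot> (\<one> ?H \<otimes> \<delta>\<^bsub>H\<^esub>) =
    ((b \<otimes> \<one> ?H) \<cdot> ((b \<otimes> \<one> ?H) \<otimes> g)) \<cdot> (\<one> ?H \<otimes> f \<otimes> \<one> ?H) \<cdot> (\<one> ?H \<otimes> \<delta>\<^bsub>H\<^esub>)"
    using Cmp_chain[of "\<one> ?H \<otimes> g" "b \<otimes> \<one> ?H \<otimes> \<one> ?H" "b \<otimes> \<one> ?H \<otimes> g" "(\<one> ?H \<otimes> f \<otimes> \<one> ?H) \<cdot> (\<one> ?H \<otimes> \<delta>\<^bsub>H\<^esub>)"]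
    unfolding beta_tilde_def by (simp add: layers) (simp add: diag)
  also have "(b \<otimes> \<one> ?H) \<cdot> ((b \<otimes> \<one> ?H) \<otimes> g) = (b \<otimes> \<one> ?H) \<cdot> (\<one> ?H \<otimes> \<one> Hs \<otimes> b \<otimes> \<one> ?H) \<cdot> (\<one> ?H \<otimes> \<one> Hs \<otimes> \<one> ?H \<otimes> g)"
    by (simp add: diag slide)
  also have "\<dots> \<cdot> (\<one> ?H \<otimes> f \<otimes> \<one> ?H) \<cdot> (\<one> ?H \<otimes> \<delta>\<^bsub>H\<^esub>) =
    (b \<otimes> \<one> ?H) \<cdot> (\<one> ?H \<otimes> ((\<one> Hs \<otimes> b \<otimes> \<one> ?H) \<cdot> (f \<otimes> g) \<cdot> \<delta>\<^bsub>H\<^esub>))"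
  proof -
    have "(\<one> ?H \<otimes> \<one> Hs \<otimes> \<one> ?H \<otimes> g) \<cdot> (\<one> ?H \<otimes> f \<otimes> \<one> ?H) = \<one> ?H \<otimes> f \<otimes> g"
      by (simp add: diag)
    from Cmp_chain[OF this, of "\<one> ?H \<otimes> \<delta>\<^bsub>H\<^esub>"] show ?thesis
      by (simp add: layers)
  qed
  also have "\<dots> = ((b \<otimes> \<one> ?H) \<cdot> (\<one> ?H \<otimes> a)) \<cdot> (\<one> ?H \<otimes> \<epsilon>\<^bsub>H\<^esub>)"
    unfolding e using TenM_unit_dom[of a "\<epsilon>\<^bsub>H\<^esub>"] by (simp add: layers)
  finally show ?thesis unfolding ab(8) by (simp add: Cmp_one_left)
qed

context
  fixes H :: "('o, 'm, 'y) hopf_scheme" and m \<Phi> a b \<beta> :: 'm and Hs :: 'o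
  assumes Tw: "twisted_post_hopf_algebra C H m \<Phi> Hs a b"
    and \<beta>: "convolution_inverse C H Hs a b (alpha C H m Hs a) \<beta>"
begin

lemma twisted_weak: "weak_twisted_post_hopf_algebra C H m \<Phi>" and twisted_finite: "finite_via C (obj H) Hs a b"
  and Phi_unit: "\<Phi> \<cdot> \<eta>\<^bsub>H\<^esub> = \<eta>\<^bsub>H\<^esub>"
  using Tw unfolding twisted_post_hopf_algebra_def by auto

lemmas THD = hopf_algebraD[OF weakD(1)[OF twisted_weak]]

lemma dual_arrs: "Hs \<in> Obj C" "a \<in> Arr C" "Dom C a = \<K>" "Cod C a = Hs \<odot> obj H" "b \<in> Arr C"
    "Dom C b = obj H \<odot> Hs" "Cod C b = \<K>"
  "\<beta> \<in> Arr C" "Dom C \<beta> = obj H" "Cod C \<beta> = Hs \<odot> obj H"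
proof -
  have "Hs \<in> Obj C" and a: "a \<in> hom C \<K> (Hs \<odot> obj H)" and b: "b \<in> hom C (obj H \<odot> Hs) \<K>"
    using twisted_finite unfolding finite_via_def by blast+
  moreover have g: "\<beta> \<in> hom C (obj H) (Hs \<odot> obj H)"
    using \<beta> unfolding convolution_inverse_def by blast
  ultimately show "Hs \<in> Obj C" "a \<in> Arr C" "Dom C a = \<K>" "Cod C a = Hs \<odot> obj H" "b \<in> Arr C"
    "Dom C b = obj H \<odot> Hs" "Cod C b = \<K>"
  "\<beta> \<in> Arr C" "Dom C \<beta> = obj H" "Cod C \<beta> = Hs \<odot> obj H"
    using in_homD[OF a] in_homD[OF b] in_homD[OF g] by blast+
qed

lemmas tarrs = arrs[OF twisted_weak] dual_arrs

text \<open>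
  \<open>act_op\<close> is the action with its arguments exchanged, namely \<open>m\<close> composed with the inverse braiding
  (\<open>act_op_Braid\<close>); \<open>inv_act\<close> undoes it in the convolution sense
  (\<open>act_op_inverse\<close>).
\<close>

abbreviation act_op where "act_op \<equiv> beta_tilde C H b (alpha C H m Hs a)"
abbreviation inv_act where "inv_act \<equiv> beta_tilde C H b \<beta>"

lemma act_arrs:
  "alpha C H m Hs a \<in> Arr C" "Dom C (alpha C H m Hs a) = obj H" "Cod C (alpha C H m Hs a) = Hs \<odot> obj H"
  "act_op \<in> Arr C" "Dom C act_op = obj H \<odot> obj H" "Cod C act_op = obj H"
  "inv_act \<in> Arr C" "Dom C inv_act = obj H \<odot> obj H" "Cod C inv_act = obj H"
  by (simp_all add: alpha_def beta_tilde_def tarrs)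

lemma act_op_inverse:
  "inv_act \<cdot> (act_op \<otimes> \<one> (obj H)) \<cdot> (\<one> (obj H) \<otimes> \<delta>\<^bsub>H\<^esub>) = \<one> (obj H) \<otimes> \<epsilon>\<^bsub>H\<^esub>"
  "act_op \<cdot> (inv_act \<otimes> \<one> (obj H)) \<cdot> (\<one> (obj H) \<otimes> \<delta>\<^bsub>H\<^esub>) = \<one> (obj H) \<otimes> \<epsilon>\<^bsub>H\<^esub>"
proof -
  have "alpha C H m Hs a \<in> hom C (obj H) (Hs \<odot> obj H)" by (simp add: in_homI act_arrs)
  then show "inv_act \<cdot> (act_op \<otimes> \<one> (obj H)) \<cdot> (\<one> (obj H) \<otimes> \<delta>\<^bsub>H\<^esub>) = \<one> (obj H) \<otimes> \<epsilon>\<^bsub>H\<^esub>"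
    "act_op \<cdot> (inv_act \<otimes> \<one> (obj H)) \<cdot> (\<one> (obj H) \<otimes> \<delta>\<^bsub>H\<^esub>) = \<one> (obj H) \<otimes> \<epsilon>\<^bsub>H\<^esub>"
    using \<beta> unfolding convolution_inverse_def
    by (blast intro: beta_tilde_conv[OF THD(2) twisted_finite])+
qed

lemma act_op_Braid: "act_op \<cdot> \<c> (obj H) (obj H) = m"
proof -
  note [simp] = tarrs
  let ?H = "obj H"
  have zz: "(b \<otimes> \<one> ?H) \<cdot> (\<one> ?H \<otimes> a) = \<one> ?H" using twisted_finite unfolding finite_via_def by blast
  have "act_op \<cdot> \<c> ?H ?H = (b \<otimes> \<one> ?H) \<cdot> (\<one> ?H \<otimes> \<one> Hs \<otimes> m) \<cdot> (\<one> ?H \<otimes> \<c> ?H Hs \<otimes> \<one> ?H) \<cdot> (\<one> ?H \<otimes> \<one> ?H \<otimes> a)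
      \<cdot> \<c> ?H ?H"
    unfolding beta_tilde_def alpha_def by (simp add: layers)
  also have "(\<one> ?H \<otimes> \<one> ?H \<otimes> a) \<cdot> \<c> ?H ?H = (\<c> ?H ?H \<otimes> \<one> Hs \<otimes> \<one> ?H) \<cdot> (\<one> ?H \<otimes> \<one> ?H \<otimes> a)"
    using TenM_unit_dom[of a "\<c> ?H ?H"] by (simp add: diag)
  also have "(b \<otimes> \<one> ?H) \<cdot> (\<one> ?H \<otimes> \<one> Hs \<otimes> m) \<cdot> (\<one> ?H \<otimes> \<c> ?H Hs \<otimes> \<one> ?H) \<cdot> \<dots> =
     (b \<otimes> m) \<cdot> (\<c> ?H (?H \<odot> Hs) \<otimes> \<one> ?H) \<cdot> (\<one> ?H \<otimes> \<one> ?H \<otimes> a)"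
  proof -
    have "(b \<otimes> \<one> ?H) \<cdot> (\<one> ?H \<otimes> \<one> Hs \<otimes> m) = b \<otimes> m" by (simp add: diag)
    from Cmp_chain[OF this, of "(\<one> ?H \<otimes> \<c> ?H Hs \<otimes> \<one> ?H) \<cdot> (\<c> ?H ?H \<otimes> \<one> Hs \<otimes> \<one> ?H) \<cdot> (\<one> ?H \<otimes> \<one> ?H \<otimes> a)"]
    show ?thesis by (simp add: Braid_TenO_right layers)
  qed
  also have "\<dots> = m \<cdot> ((\<c> ?H \<K> \<cdot> (\<one> ?H \<otimes> b)) \<otimes> \<one> ?H) \<cdot> (\<one> ?H \<otimes> \<one> ?H \<otimes> a)"
    using slide_left_chain[of b "\<one> ?H \<otimes> \<one> ?H" m "(\<c> ?H (?H \<odot> Hs) \<otimes> \<one> ?H) \<cdot> (\<one> ?H \<otimes> \<one> ?H \<otimes> a)"]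
    by (simp add: Braid_nat layers)
  also have "\<dots> = m \<cdot> (\<one> ?H \<otimes> ((b \<otimes> \<one> ?H) \<cdot> (\<one> ?H \<otimes> a)))"
    by (simp add: Braid_unit_right diag)
  finally show ?thesis unfolding zz by (simp add: diag)
qed

text \<open>The action of the unit is idempotent, and it has a left inverse given by \<open>inv_act\<close> at the unit.\<close>

lemma act_one: "m \<cdot> (\<eta>\<^bsub>H\<^esub> \<otimes> \<one> (obj H)) = \<one> (obj H)"
proof -
  note [simp] = tarrs act_arrs mu_bar_arr[OF twisted_weak]
  let ?H = "obj H" and ?f = "m \<cdot> (\<eta>\<^bsub>H\<^esub> \<otimes> \<one> (obj H))" and ?M = "mu_bar C H m \<Phi>"
  have fop: "act_op \<cdot> (\<one> ?H \<otimes> \<eta>\<^bsub>H\<^esub>) = ?f"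
  proof -
    have "?f = act_op \<cdot> \<c> ?H ?H \<cdot> (\<eta>\<^bsub>H\<^esub> \<otimes> \<one> ?H)"
      using Cmp_chain[OF act_op_Braid, of "\<eta>\<^bsub>H\<^esub> \<otimes> \<one> ?H"] by simp
    then show ?thesis by (simp add: Braid_nat Braid_unit_left diag)
  qed
  have "\<delta>\<^bsub>H\<^esub> \<cdot> \<eta>\<^bsub>H\<^esub> = \<eta>\<^bsub>H\<^esub> \<otimes> \<eta>\<^bsub>H\<^esub>" by (rule THD(5))
  then have "inv_act \<cdot> (act_op \<otimes> \<one> ?H) \<cdot> (\<one> ?H \<otimes> \<delta>\<^bsub>H\<^esub>) \<cdot> (\<one> ?H \<otimes> \<eta>\<^bsub>H\<^esub>)
      = inv_act \<cdot> ((act_op \<cdot> (\<one> ?H \<otimes> \<eta>\<^bsub>H\<^esub>)) \<otimes> \<eta>\<^bsub>H\<^esub>)"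
    by (simp add: diag)
  also have "\<dots> = (inv_act \<cdot> (\<one> ?H \<otimes> \<eta>\<^bsub>H\<^esub>)) \<cdot> ?f"
    unfolding fop using TenM_unit_dom[of "\<eta>\<^bsub>H\<^esub>" ?f] by (simp add: Cmp_assoc_arr)
  finally have "(inv_act \<cdot> (\<one> ?H \<otimes> \<eta>\<^bsub>H\<^esub>)) \<cdot> ?f =
    (inv_act \<cdot> (act_op \<otimes> \<one> ?H) \<cdot> (\<one> ?H \<otimes> \<delta>\<^bsub>H\<^esub>)) \<cdot> (\<one> ?H \<otimes> \<eta>\<^bsub>H\<^esub>)"
    by (simp add: Cmp_assoc_arr)
  also have "\<dots> = \<one> ?H"
    unfolding act_op_inverse by (simp add: interchange THD(4) diag)
  finally have l: "(inv_act \<cdot> (\<one> ?H \<otimes> \<eta>\<^bsub>H\<^esub>)) \<cdot> ?f = \<one> ?H" .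
  have \<eta>\<eta>: "?M \<cdot> (\<eta>\<^bsub>H\<^esub> \<otimes> \<eta>\<^bsub>H\<^esub>) = \<eta>\<^bsub>H\<^esub>"
  proof -
    have "?M \<cdot> (\<eta>\<^bsub>H\<^esub> \<otimes> \<eta>\<^bsub>H\<^esub>) = (?M \<cdot> (\<one> ?H \<otimes> \<eta>\<^bsub>H\<^esub>)) \<cdot> \<eta>\<^bsub>H\<^esub>"
      using TenM_unit_dom[of "\<eta>\<^bsub>H\<^esub>" "\<eta>\<^bsub>H\<^esub>"] by (simp add: Cmp_assoc_arr)
    then show ?thesis by (simp add: mu_bar_unit_right[OF twisted_weak] Phi_unit)
  qed
  have "?f \<cdot> ?f = (m \<cdot> (\<one> ?H \<otimes> m)) \<cdot> (\<eta>\<^bsub>H\<^esub> \<otimes> \<eta>\<^bsub>H\<^esub> \<otimes> \<one> ?H)"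
  proof -
    have "\<eta>\<^bsub>H\<^esub> \<otimes> ?f = (\<eta>\<^bsub>H\<^esub> \<otimes> \<one> ?H) \<cdot> ?f"
      using interchange[of "\<one> \<K>" ?f "\<eta>\<^bsub>H\<^esub>" "\<one> ?H"]
      by (simp add: TenM_unit_left Cmp_one_left Cmp_one_right)
    moreover have "(\<one> ?H \<otimes> m) \<cdot> (\<eta>\<^bsub>H\<^esub> \<otimes> \<eta>\<^bsub>H\<^esub> \<otimes> \<one> ?H) = \<eta>\<^bsub>H\<^esub> \<otimes> ?f"
      by (simp add: diag)
    ultimately show ?thesis by (simp add: Cmp_assoc_arr)
  qed
  also have "\<dots> = m \<cdot> ((?M \<cdot> (\<eta>\<^bsub>H\<^esub> \<otimes> \<eta>\<^bsub>H\<^esub>)) \<otimes> \<one> ?H)"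
    unfolding weakD(5)[OF twisted_weak] by (simp add: diag)
  also have "\<dots> = ?f" unfolding \<eta>\<eta> ..
  finally show ?thesis
    by (intro idempotent_iso_Ident[OF _ _ l]) (simp_all add: in_homI)
qed

lemma mu_bar_unit_left: "mu_bar C H m \<Phi> \<cdot> (\<eta>\<^bsub>H\<^esub> \<otimes> \<one> (obj H)) = \<one> (obj H)"
proof -
  note [simp] = tarrs
  have "mu_bar C H m \<Phi> \<cdot> (\<eta>\<^bsub>H\<^esub> \<otimes> \<one> (obj H)) = \<mu>\<^bsub>H\<^esub> \<cdot> (\<Phi> \<otimes> m) \<cdot> ((\<delta>\<^bsub>H\<^esub> \<cdot> \<eta>\<^bsub>H\<^esub>) \<otimes> \<one> (obj H))"
    unfolding mu_bar_def by (simp add: diag)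
  also have "\<dots> = \<mu>\<^bsub>H\<^esub> \<cdot> ((\<Phi> \<cdot> \<eta>\<^bsub>H\<^esub>) \<otimes> (m \<cdot> (\<eta>\<^bsub>H\<^esub> \<otimes> \<one> (obj H))))"
    by (simp add: THD(5) diag)
  finally show ?thesis unfolding Phi_unit act_one algebra_laws[OF THD(1)] .
qed

abbreviation S where "S \<equiv> S_mor C H \<Phi> b \<beta>"

lemma S_alt: "S = inv_act \<cdot> ((antipode H \<cdot> \<Phi>) \<otimes> \<one> (obj H)) \<cdot> \<delta>\<^bsub>H\<^esub>"
  unfolding S_mor_def beta_tilde_def by (simp add: tarrs diag)

lemma S_arr: "S \<in> Arr C" "Dom C S = obj H" "Cod C S = obj H"
  unfolding S_mor_def by (simp_all add: tarrs)

lemma S_coalgebra_morphism: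
  assumes co: "cocommutative C H" and B: "coalgebra_morphism C (tensor_coalgebra C H H) H inv_act"
  shows "coalgebra_morphism C H H S"
proof -
  note D = THD(2) and T = tensor_coalgebra[OF THD(2) THD(2)]
  have "coalgebra_morphism C H H (antipode H \<cdot> \<Phi>)"
    by (rule coalgebra_morphism_comp[OF D D D weakD(3)[OF twisted_weak]
        cocommutative_antipode_coalgebra_morphism[OF weakD(1)[OF twisted_weak] co]])
  then have "coalgebra_morphism C (tensor_coalgebra C H H) (tensor_coalgebra C H H)
     ((antipode H \<cdot> \<Phi>) \<otimes> \<one> (obj H))"
    by (rule tensor_coalgebra_morphism[OF D D D D _ coalgebra_morphism_Ident[OF D]])
  from coalgebra_morphism_comp[OF D T T cocommutative_comult_morphism[OF D co] this]
  show ?thesis unfolding S_alt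
    by (rule coalgebra_morphism_comp[OF D T D _ B])
qed

text \<open>In elements, \<open>x\<^sub>1 \<rhd> S x\<^sub>2 = \<lambda> (\<Phi> x)\<close> with \<open>\<lambda>\<close> the antipode of \<open>H\<close>.\<close>

lemma act_S:
  assumes co: "cocommutative C H"
  shows "m \<cdot> (\<one> (obj H) \<otimes> S) \<cdot> \<delta>\<^bsub>H\<^esub> = antipode H \<cdot> \<Phi>"
proof -
  note [simp] = tarrs act_arrs S_arr
  let ?H = "obj H" and ?g = "antipode H \<cdot> \<Phi>"
  have c: "\<c> ?H ?H \<cdot> \<delta>\<^bsub>H\<^esub> = \<delta>\<^bsub>H\<^esub>" using co unfolding cocommutative_def .
  have "m \<cdot> (\<one> ?H \<otimes> S) \<cdot> \<delta>\<^bsub>H\<^esub> = act_op \<cdot> (\<c> ?H ?H \<cdot> (\<one> ?H \<otimes> S)) \<cdot> \<delta>\<^bsub>H\<^esub>"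
    using Cmp_chain[OF act_op_Braid, of "(\<one> ?H \<otimes> S) \<cdot> \<delta>\<^bsub>H\<^esub>"] by (simp add: Cmp_assoc_arr)
  also have "\<dots> = act_op \<cdot> (S \<otimes> \<one> ?H) \<cdot> \<c> ?H ?H \<cdot> \<delta>\<^bsub>H\<^esub>"
    by (simp add: Braid_nat Cmp_assoc_arr)
  also have "\<dots> = act_op \<cdot> (inv_act \<otimes> \<one> ?H) \<cdot> (?g \<otimes> \<one> ?H \<otimes> \<one> ?H) \<cdot> (\<delta>\<^bsub>H\<^esub> \<otimes> \<one> ?H) \<cdot> \<delta>\<^bsub>H\<^esub>"
    unfolding c S_alt by (simp add: diag)
  also have "\<dots> = (act_op \<cdot> (inv_act \<otimes> \<one> ?H) \<cdot> (\<one> ?H \<otimes> \<delta>\<^bsub>H\<^esub>)) \<cdot> (?g \<otimes> \<one> ?H) \<cdot> \<delta>\<^bsub>H\<^esub>"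
    unfolding coalgebra_laws[OF THD(2)] by (simp add: diag)
  also have "\<dots> = ?g \<cdot> (\<one> ?H \<otimes> \<epsilon>\<^bsub>H\<^esub>) \<cdot> \<delta>\<^bsub>H\<^esub>"
    unfolding act_op_inverse by (simp add: diag slide)
  finally show ?thesis unfolding coalgebra_laws[OF THD(2)] by (simp add: diag)
qed

lemma mu_bar_S:
  assumes co: "cocommutative C H"
  shows "mu_bar C H m \<Phi> \<cdot> (\<one> (obj H) \<otimes> S) \<cdot> \<delta>\<^bsub>H\<^esub> = \<eta>\<^bsub>H\<^esub> \<cdot> \<epsilon>\<^bsub>H\<^esub>"
proof -
  note [simp] = tarrs act_arrs S_arr
  let ?H = "obj H"
  note \<Phi> = coalgebra_morphismD[OF weakD(3)[OF twisted_weak]]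
  have id: "\<one> ?H \<in> hom C ?H ?H" by (simp add: in_homI)
  have "mu_bar C H m \<Phi> \<cdot> (\<one> ?H \<otimes> S) \<cdot> \<delta>\<^bsub>H\<^esub> = \<mu>\<^bsub>H\<^esub> \<cdot> (\<Phi> \<otimes> (m \<cdot> (\<one> ?H \<otimes> S))) \<cdot> (\<delta>\<^bsub>H\<^esub> \<otimes> \<one> ?H) \<cdot> \<delta>\<^bsub>H\<^esub>"
  proof -
    have "(\<Phi> \<otimes> m) \<cdot> (\<one> ?H \<otimes> \<one> ?H \<otimes> S) = \<Phi> \<otimes> (m \<cdot> (\<one> ?H \<otimes> S))"
      by (simp add: diag)
    from Cmp_chain[OF this, of "(\<delta>\<^bsub>H\<^esub> \<otimes> \<one> ?H) \<cdot> \<delta>\<^bsub>H\<^esub>"]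
    have 1: "(\<Phi> \<otimes> m) \<cdot> (\<one> ?H \<otimes> \<one> ?H \<otimes> S) \<cdot> (\<delta>\<^bsub>H\<^esub> \<otimes> \<one> ?H) \<cdot> \<delta>\<^bsub>H\<^esub>
        = (\<Phi> \<otimes> (m \<cdot> (\<one> ?H \<otimes> S))) \<cdot> (\<delta>\<^bsub>H\<^esub> \<otimes> \<one> ?H) \<cdot> \<delta>\<^bsub>H\<^esub>"
      by simp
    have "(\<delta>\<^bsub>H\<^esub> \<otimes> \<one> ?H) \<cdot> (\<one> ?H \<otimes> S) = (\<one> ?H \<otimes> \<one> ?H \<otimes> S) \<cdot> (\<delta>\<^bsub>H\<^esub> \<otimes> \<one> ?H)"
      by (simp add: diag)
    from Cmp_chain[OF this, of "\<delta>\<^bsub>H\<^esub>"] show ?thesis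
      unfolding 1[symmetric] mu_bar_def by (simp add: Cmp_assoc_arr)
  qed
  also have "\<dots> = \<mu>\<^bsub>H\<^esub> \<cdot> (\<Phi> \<otimes> (m \<cdot> (\<one> ?H \<otimes> S) \<cdot> \<delta>\<^bsub>H\<^esub>)) \<cdot> \<delta>\<^bsub>H\<^esub>"
    unfolding coalgebra_laws[OF THD(2)] by (simp add: diag)
  also have "\<dots> = conv H H (\<one> ?H) (antipode H) \<cdot> \<Phi>"
    unfolding act_S[OF co] using conv_comp_coalgebra_morphism[OF THD(2) THD(2) THD(1) weakD(3)[OF
        twisted_weak] id THD(3)]
    by (simp add: conv_def Cmp_one_left)
  finally show ?thesis unfolding THD(7) by (simp add: Cmp_assoc_arr \<Phi>(2))
qed

end

section \<open>Coalgebras on split idempotents\<close>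

lemma splittingD:
  assumes "splitting C X q I p i"
  shows "I \<in> Obj C" "p \<in> Arr C" "Dom C p = X" "Cod C p = I" "i \<in> Arr C" "Dom C i = I" "Cod C i = X"
    "i \<cdot> p = q" "p \<cdot> i = \<one> I" "p \<cdot> q = p" "q \<cdot> i = i"
proof -
  have p: "p \<in> hom C X I" and i: "i \<in> hom C I X" and q: "i \<cdot> p = q" and pi: "p \<cdot> i = \<one> I"
    using assms unfolding splitting_def by auto
  note [simp] = in_homD[OF p] in_homD[OF i]
  show "I \<in> Obj C" "p \<in> Arr C" "Dom C p = X" "Cod C p = I" "i \<in> Arr C" "Dom C i = I" "Cod C i = X"
    "i \<cdot> p = q" "p \<cdot> i = \<one> I" by (simp_all add: q pi)
  have "p \<cdot> i \<cdot> p = (p \<cdot> i) \<cdot> p" "(i \<cdot> p) \<cdot> i = i \<cdot> p \<cdot> i"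
    by (simp_all add: Cmp_assoc_arr)
  then show "p \<cdot> q = p" "q \<cdot> i = i"
    unfolding q pi by (simp_all add: Cmp_one_left Cmp_one_right)
qed

lemma splitting_coalgebra:
  assumes D: "coalgebra C D" and q: "coalgebra_morphism C D D q" and sp: "splitting C (obj D) q I p i"
    and J: "obj J = I" "\<epsilon>\<^bsub>J\<^esub> = \<epsilon>\<^bsub>D\<^esub> \<cdot> i" "\<delta>\<^bsub>J\<^esub> = (p \<otimes> p) \<cdot> \<delta>\<^bsub>D\<^esub> \<cdot> i"
  shows "coalgebra C J" "coalgebra_morphism C D J p" "coalgebra_morphism C J D i"
    and "cocommutative C D \<Longrightarrow> cocommutative C J"
proof -
  note s = splittingD[OF sp]
  note [simp] = coalgebraD[OF D] s(1-7) in_homD[OF coalgebra_morphismD(1)[OF q]]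
  note q' = coalgebra_morphismD[OF q]
  have \<epsilon>p: "(\<epsilon>\<^bsub>D\<^esub> \<cdot> i) \<cdot> p = \<epsilon>\<^bsub>D\<^esub>" by (simp add: Cmp_assoc_arr s q')
  have \<delta>p: "((p \<otimes> p) \<cdot> \<delta>\<^bsub>D\<^esub> \<cdot> i) \<cdot> p = (p \<otimes> p) \<cdot> \<delta>\<^bsub>D\<^esub>"
    by (simp add: Cmp_assoc_arr s q' interchange_chain)
  have \<delta>i: "(i \<otimes> i) \<cdot> (p \<otimes> p) \<cdot> \<delta>\<^bsub>D\<^esub> \<cdot> i = \<delta>\<^bsub>D\<^esub> \<cdot> i"
  proof -
    have "(i \<otimes> i) \<cdot> (p \<otimes> p) \<cdot> \<delta>\<^bsub>D\<^esub> \<cdot> i = ((q \<otimes> q) \<cdot> \<delta>\<^bsub>D\<^esub>) \<cdot> i"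
      by (simp add: interchange_chain s(8) Cmp_assoc_arr)
    also have "\<dots> = \<delta>\<^bsub>D\<^esub> \<cdot> q \<cdot> i" unfolding q'(3)[symmetric] by (simp add: Cmp_assoc_arr)
    finally show ?thesis by (simp add: s)
  qed
  show "coalgebra_morphism C D J p"
    unfolding coalgebra_morphism_def J by (simp add: in_homI \<epsilon>p \<delta>p)
  show "coalgebra_morphism C J D i"
    unfolding coalgebra_morphism_def J by (simp add: in_homI \<delta>i)
  have l: "((\<epsilon>\<^bsub>D\<^esub> \<cdot> i) \<otimes> \<one> I) \<cdot> (p \<otimes> p) \<cdot> \<delta>\<^bsub>D\<^esub> \<cdot> i = \<one> I"
  proof -
    have "((\<epsilon>\<^bsub>D\<^esub> \<cdot> i) \<otimes> \<one> I) \<cdot> (p \<otimes> p) \<cdot> \<delta>\<^bsub>D\<^esub> \<cdot> i = (\<epsilon>\<^bsub>D\<^esub> \<otimes> p) \<cdot> \<delta>\<^bsub>D\<^esub> \<cdot> i"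
      by (simp add: interchange_chain \<epsilon>p Cmp_one_left)
    also have "\<dots> = p \<cdot> ((\<epsilon>\<^bsub>D\<^esub> \<otimes> \<one> (obj D)) \<cdot> \<delta>\<^bsub>D\<^esub>) \<cdot> i"
      by (simp add: slide diag)
    finally show ?thesis unfolding coalgebra_laws[OF D] by (simp add: Cmp_one_left s)
  qed
  have r: "(\<one> I \<otimes> (\<epsilon>\<^bsub>D\<^esub> \<cdot> i)) \<cdot> (p \<otimes> p) \<cdot> \<delta>\<^bsub>D\<^esub> \<cdot> i = \<one> I"
  proof -
    have "(\<one> I \<otimes> (\<epsilon>\<^bsub>D\<^esub> \<cdot> i)) \<cdot> (p \<otimes> p) \<cdot> \<delta>\<^bsub>D\<^esub> \<cdot> i = (p \<otimes> \<epsilon>\<^bsub>D\<^esub>) \<cdot> \<delta>\<^bsub>D\<^esub> \<cdot> i"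
      by (simp add: interchange_chain \<epsilon>p Cmp_one_left)
    also have "\<dots> = p \<cdot> ((\<one> (obj D) \<otimes> \<epsilon>\<^bsub>D\<^esub>) \<cdot> \<delta>\<^bsub>D\<^esub>) \<cdot> i"
      by (simp add: slide diag)
    finally show ?thesis unfolding coalgebra_laws[OF D] by (simp add: Cmp_one_left s)
  qed
  have a: "(((p \<otimes> p) \<cdot> \<delta>\<^bsub>D\<^esub> \<cdot> i) \<otimes> \<one> I) \<cdot> (p \<otimes> p) \<cdot> \<delta>\<^bsub>D\<^esub> \<cdot> i
      = (\<one> I \<otimes> ((p \<otimes> p) \<cdot> \<delta>\<^bsub>D\<^esub> \<cdot> i)) \<cdot> (p \<otimes> p) \<cdot> \<delta>\<^bsub>D\<^esub> \<cdot> i"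
  proof -
    have "(((p \<otimes> p) \<cdot> \<delta>\<^bsub>D\<^esub> \<cdot> i) \<otimes> \<one> I) \<cdot> (p \<otimes> p) \<cdot> \<delta>\<^bsub>D\<^esub> \<cdot> i = (((p \<otimes> p) \<cdot> \<delta>\<^bsub>D\<^esub>) \<otimes> p) \<cdot> \<delta>\<^bsub>D\<^esub> \<cdot> i"
      by (subst interchange_chain) (simp_all add: \<delta>p Cmp_one_left)
    also have "\<dots> = (p \<otimes> p \<otimes> p) \<cdot> ((\<delta>\<^bsub>D\<^esub> \<otimes> \<one> (obj D)) \<cdot> \<delta>\<^bsub>D\<^esub>) \<cdot> i"
      by (simp add: diag)
    also have "\<dots> = (p \<otimes> ((p \<otimes> p) \<cdot> \<delta>\<^bsub>D\<^esub>)) \<cdot> \<delta>\<^bsub>D\<^esub> \<cdot> i"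
      unfolding coalgebra_laws[OF D] by (simp add: diag)
    also have "\<dots> = (\<one> I \<otimes> ((p \<otimes> p) \<cdot> \<delta>\<^bsub>D\<^esub> \<cdot> i)) \<cdot> (p \<otimes> p) \<cdot> \<delta>\<^bsub>D\<^esub> \<cdot> i"
      by (subst interchange_chain) (simp_all add: \<delta>p Cmp_one_left)
    finally show ?thesis .
  qed
  show "coalgebra C J"
    unfolding coalgebra_def J using l r a by (simp add: in_homI)
  show "cocommutative C J" if "cocommutative C D"
  proof -
    have "\<c> I I \<cdot> (p \<otimes> p) = (p \<otimes> p) \<cdot> \<c> (obj D) (obj D)" by (simp add: Braid_nat)
    from Cmp_chain[OF this, of "\<delta>\<^bsub>D\<^esub> \<cdot> i"]
    have "\<c> I I \<cdot> (p \<otimes> p) \<cdot> \<delta>\<^bsub>D\<^esub> \<cdot> i = (p \<otimes> p) \<cdot> (\<c> (obj D) (obj D) \<cdot> \<delta>\<^bsub>D\<^esub>) \<cdot> i"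
      by (simp add: Cmp_assoc_arr)
    then show ?thesis using that unfolding cocommutative_def J by simp
  qed
qed

section \<open>The Hopf algebra structure on the image\<close>

lemma image_hopf_algebra:
  assumes Tw: "twisted_post_hopf_algebra C H m \<Phi> Hs a b"
    and co: "cocommutative C H"
    and \<beta>: "convolution_inverse C H Hs a b (alpha C H m Hs a) \<beta>"
    and B: "coalgebra_morphism C (tensor_coalgebra C H H) H (beta_tilde C H b \<beta>)"
    and sp: "splitting C (obj H) \<Phi> I p i"
  shows "hopf_algebra C (image_hopf C H m \<Phi> b \<beta> I p i)" "cocommutative C (image_hopf C H m \<Phi> b \<beta> I p i)"
proof -
  note W = twisted_weak[OF Tw \<beta>]
  note HD = hopf_algebraD[OF weakD(1)[OF W]]
  note D = HD(2)
  let ?J = "image_hopf C H m \<Phi> b \<beta> I p i" and ?H = "obj H" and ?M = "mu_bar C H m \<Phi>"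
    and ?S = "S_mor C H \<Phi> b \<beta>"
  have J: "obj ?J = I" "\<epsilon>\<^bsub>?J\<^esub> = \<epsilon>\<^bsub>H\<^esub> \<cdot> i" "\<delta>\<^bsub>?J\<^esub> = (p \<otimes> p) \<cdot> \<delta>\<^bsub>H\<^esub> \<cdot> i"
    "\<eta>\<^bsub>?J\<^esub> = p \<cdot> \<eta>\<^bsub>H\<^esub>" "\<mu>\<^bsub>?J\<^esub> = p \<cdot> ?M \<cdot> (i \<otimes> i)" "antipode ?J = p \<cdot> ?S \<cdot> i"
    unfolding image_hopf_def by simp_all
  note s = splittingD[OF sp]
  note [simp] = tarrs[OF Tw \<beta>] mu_bar_arr[OF W] S_arr[OF Tw \<beta>] s(1-7)
  note cJ = splitting_coalgebra[OF D weakD(3)[OF W] sp J(1-3)]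
  note p = cJ(2) and i = cJ(3)
  note T = tensor_coalgebra[OF D D] and TJ = tensor_coalgebra[OF cJ(1) cJ(1)]
  note M\<Phi> = Phi_mu_bar[OF W]
  show "cocommutative C ?J" by (rule cJ(4)[OF co])

  have \<mu>: "coalgebra_morphism C (tensor_coalgebra C ?J ?J) ?J \<mu>\<^bsub>?J\<^esub>"
    unfolding J(5)
    by (rule coalgebra_morphism_comp[OF TJ D cJ(1) coalgebra_morphism_comp[OF TJ T D
          tensor_coalgebra_morphism[OF cJ(1) cJ(1) D D i i] mu_bar_coalgebra_morphism[OF W co]] p])
  have K: "coalgebra C (unit_coalgebra C)"
    unfolding coalgebra_def unit_coalgebra_def by (simp add: in_homI diag)
  have "coalgebra_morphism C (unit_coalgebra C) H \<eta>\<^bsub>H\<^esub>"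
    using weakD(1)[OF W] unfolding hopf_algebra_def bialgebra_def by blast
  then have \<eta>: "coalgebra_morphism C (unit_coalgebra C) ?J \<eta>\<^bsub>?J\<^esub>"
    unfolding J(4) by (rule coalgebra_morphism_comp[OF K D cJ(1) _ p])

  have i\<eta>: "i \<cdot> p \<cdot> \<eta>\<^bsub>H\<^esub> = \<eta>\<^bsub>H\<^esub>"
    using Phi_unit[OF Tw \<beta>] by (simp add: Cmp_assoc_arr[symmetric] s(8))
  have \<Phi>M: "\<Phi> \<cdot> ?M \<cdot> (i \<otimes> i) = ?M \<cdot> (i \<otimes> i)"
  proof -
    have "(\<Phi> \<cdot> ?M) \<cdot> (i \<otimes> i) = ?M \<cdot> (i \<otimes> (\<Phi> \<cdot> i))"
      unfolding M\<Phi> by (simp add: diag)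
    then show ?thesis by (simp add: Cmp_assoc_arr s(11))
  qed
  \<comment> \<open>Products of elements of the image stay in the image, so \<open>i\<close> is multiplicative for \<open>mu_bar\<close>.\<close>
  have i\<mu>: "i \<cdot> \<mu>\<^bsub>?J\<^esub> = ?M \<cdot> (i \<otimes> i)"
  proof -
    have "i \<cdot> \<mu>\<^bsub>?J\<^esub> = (i \<cdot> p) \<cdot> ?M \<cdot> (i \<otimes> i)" unfolding J(5) by (simp add: Cmp_assoc_arr)
    then show ?thesis by (simp add: s(8) \<Phi>M)
  qed
  have ul: "\<mu>\<^bsub>?J\<^esub> \<cdot> (\<eta>\<^bsub>?J\<^esub> \<otimes> \<one> I) = \<one> I"
  proof -
    have "\<mu>\<^bsub>?J\<^esub> \<cdot> (\<eta>\<^bsub>?J\<^esub> \<otimes> \<one> I) = p \<cdot> ?M \<cdot> (\<eta>\<^bsub>H\<^esub> \<otimes> i)"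
      unfolding J by (simp add: Cmp_assoc_arr interchange i\<eta> Cmp_one_right)
    also have "\<eta>\<^bsub>H\<^esub> \<otimes> i = (\<eta>\<^bsub>H\<^esub> \<otimes> \<one> ?H) \<cdot> i"
      using interchange[of "\<one> \<K>" i "\<eta>\<^bsub>H\<^esub>" "\<one> ?H"] by (simp add: TenM_unit_left Cmp_one_left Cmp_one_right)
    also have "p \<cdot> ?M \<cdot> \<dots> = p \<cdot> (?M \<cdot> (\<eta>\<^bsub>H\<^esub> \<otimes> \<one> ?H)) \<cdot> i" by (simp add: Cmp_assoc_arr)
    finally show ?thesis unfolding mu_bar_unit_left[OF Tw \<beta>] by (simp add: Cmp_one_left s(9))
  qed
  have ur: "\<mu>\<^bsub>?J\<^esub> \<cdot> (\<one> I \<otimes> \<eta>\<^bsub>?J\<^esub>) = \<one> I"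
  proof -
    have "\<mu>\<^bsub>?J\<^esub> \<cdot> (\<one> I \<otimes> \<eta>\<^bsub>?J\<^esub>) = p \<cdot> ?M \<cdot> (i \<otimes> \<eta>\<^bsub>H\<^esub>)"
      unfolding J by (simp add: Cmp_assoc_arr interchange i\<eta> Cmp_one_right)
    also have "i \<otimes> \<eta>\<^bsub>H\<^esub> = (\<one> ?H \<otimes> \<eta>\<^bsub>H\<^esub>) \<cdot> i"
      using TenM_unit_dom[of "\<eta>\<^bsub>H\<^esub>" i] by simp
    also have "p \<cdot> ?M \<cdot> \<dots> = p \<cdot> (?M \<cdot> (\<one> ?H \<otimes> \<eta>\<^bsub>H\<^esub>)) \<cdot> i" by (simp add: Cmp_assoc_arr)
    finally show ?thesis unfolding mu_bar_unit_right[OF W] by (simp add: s(9,11))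
  qed
  have \<mu>t: "\<mu>\<^bsub>?J\<^esub> \<in> Arr C" "Dom C \<mu>\<^bsub>?J\<^esub> = I \<odot> I" "Cod C \<mu>\<^bsub>?J\<^esub> = I" unfolding J by simp_all
  have as: "\<mu>\<^bsub>?J\<^esub> \<cdot> (\<mu>\<^bsub>?J\<^esub> \<otimes> \<one> I) = \<mu>\<^bsub>?J\<^esub> \<cdot> (\<one> I \<otimes> \<mu>\<^bsub>?J\<^esub>)"
  proof -
    have "\<mu>\<^bsub>?J\<^esub> \<cdot> (\<mu>\<^bsub>?J\<^esub> \<otimes> \<one> I) = p \<cdot> ?M \<cdot> ((i \<cdot> \<mu>\<^bsub>?J\<^esub>) \<otimes> i)"
      by (subst J(5)) (simp add: \<mu>t Cmp_assoc_arr interchange Cmp_one_right)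
    also have "\<dots> = p \<cdot> (?M \<cdot> (?M \<otimes> \<one> ?H)) \<cdot> (i \<otimes> i \<otimes> i)"
      unfolding i\<mu> by (simp add: diag)
    also have "\<dots> = p \<cdot> ?M \<cdot> (i \<otimes> (i \<cdot> \<mu>\<^bsub>?J\<^esub>))"
      unfolding i\<mu> mu_bar_assoc[OF W co] by (simp add: diag)
    also have "\<dots> = \<mu>\<^bsub>?J\<^esub> \<cdot> (\<one> I \<otimes> \<mu>\<^bsub>?J\<^esub>)"
      by (subst (2) J(5)) (simp add: \<mu>t Cmp_assoc_arr interchange Cmp_one_right)
    finally show ?thesis .
  qed
  have alg: "algebra C ?J"
    unfolding algebra_def using ul ur as by (simp add: J(1)) (simp add: J in_homI)
  have lam: "coalgebra_morphism C ?J ?J (p \<cdot> ?S \<cdot> i)"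
    by (rule coalgebra_morphism_comp[OF cJ(1) D cJ(1) coalgebra_morphism_comp[OF cJ(1) D D i
        S_coalgebra_morphism[OF Tw \<beta> co B]] p])
  have right: "conv ?J ?J (\<one> I) (p \<cdot> ?S \<cdot> i) = \<eta>\<^bsub>?J\<^esub> \<cdot> \<epsilon>\<^bsub>?J\<^esub>"
  proof -
    have "conv ?J ?J (\<one> I) (p \<cdot> ?S \<cdot> i) = p \<cdot> ?M \<cdot> (i \<otimes> i) \<cdot> (p \<otimes> (p \<cdot> ?S \<cdot> i \<cdot> p)) \<cdot> \<delta>\<^bsub>H\<^esub> \<cdot> i"
      unfolding conv_def J by (simp add: Cmp_assoc_arr interchange_chain Cmp_one_left)
    also have "\<dots> = p \<cdot> ?M \<cdot> ((i \<cdot> p) \<otimes> ((i \<cdot> p) \<cdot> ?S \<cdot> (i \<cdot> p))) \<cdot> \<delta>\<^bsub>H\<^esub> \<cdot> i"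
      by (simp add: Cmp_assoc_arr interchange_chain)
    also have "\<dots> = p \<cdot> (?M \<cdot> (\<one> ?H \<otimes> \<Phi>)) \<cdot> (\<one> ?H \<otimes> ?S) \<cdot> ((\<Phi> \<otimes> \<Phi>) \<cdot> \<delta>\<^bsub>H\<^esub>) \<cdot> i"
      unfolding s(8) by (simp add: diag)
    also have "\<dots> = (p \<cdot> \<Phi>) \<cdot> (?M \<cdot> (\<one> ?H \<otimes> ?S) \<cdot> \<delta>\<^bsub>H\<^esub>) \<cdot> \<Phi> \<cdot> i"
      unfolding M\<Phi>[symmetric] coalgebra_morphismD(3)[OF weakD(3)[OF W], symmetric]
      by (simp add: Cmp_assoc_arr)
    also have "\<dots> = \<eta>\<^bsub>?J\<^esub> \<cdot> \<epsilon>\<^bsub>?J\<^esub>"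
      unfolding mu_bar_S[OF Tw \<beta> co] s(10,11) J by (simp add: Cmp_assoc_arr)
    finally show ?thesis .
  qed
  have left: "conv ?J ?J (p \<cdot> ?S \<cdot> i) (\<one> I) = \<eta>\<^bsub>?J\<^esub> \<cdot> \<epsilon>\<^bsub>?J\<^esub>"
  proof -
    have "\<epsilon>\<^bsub>?J\<^esub> \<cdot> \<eta>\<^bsub>?J\<^esub> = \<one> \<K>" using coalgebra_morphismD(2)[OF \<eta>] by (simp add: unit_coalgebra_def)
    from right_antipode_imp_left_antipode[OF alg cJ(1) this lam] right show ?thesis by (simp add: J(1))
  qed
  show "hopf_algebra C ?J"
    unfolding hopf_algebra_def bialgebra_def
    using alg cJ(1) \<eta> \<mu> right left by (simp add: J(1,6) conv_def in_homI)
qed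

end

theorem corollary3p23:
  fixes C :: "('o, 'm, 'z) braided_category_scheme"
    and H :: "('o, 'm, 'y) hopf_scheme"
    and m \<Phi> a b \<beta> p i :: 'm
    and Hs I :: 'o
  assumes "strict_braided_monoidal_category C"
    and "admits_split_idempotents C"
    and "twisted_post_hopf_algebra C H m \<Phi> Hs a b"
    and "cocommutative C H"
    and "convolution_inverse C H Hs a b (alpha C H m Hs a) \<beta>"
    and "coalgebra_morphism C (tensor_coalgebra C H H) H (beta_tilde C H b \<beta>)"
    and "splitting C (obj H) \<Phi> I p i"
  shows "hopf_algebra C (image_hopf C H m \<Phi> b \<beta> I p i) \<and>
    cocommutative C (image_hopf C H m \<Phi> b \<beta> I p i)"
  using strict_braided_monoidal_category.image_hopf_algebra[OF assms(1) assms(3-7)] by blast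

end
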